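(* Let $(X,\mathcal E)$ be the augmented tree of an IFS $\{S_i\}_{i=1}^N$ of contractive similitudes on $\mathbb R^d$, with vertical edge set $\mathcal E_v$ and horizontal edge set $\mathcal E_h$. Suppose $(X,\mathcal E)$ is simple, and suppose its incidence matrix $A$ is $(B,\mathbf u)$-rearrangeable, where $B$ is the incidence matrix of the tree $(X,\mathcal E_v)$ and $\mathbf u$ is the representation of the equivalence classes of horizontal components by the equivalence classes of vertices. Then there exists a near-isometry between the augmented tree $(X,\mathcal E)$ and the tree $(X,\mathcal E_v)$, and consequently the hyperbolic boundaries are Lipschitz equivalent: $\partial(X,\mathcal E)\simeq\partial(X,\mathcal E_v)$.
   Context: **Augmented tree.** Let $\{S_i\}_{i=1}^N$ be an iterated function system (IFS) of contractive similitudes on $\mathbb R^d$, $S_i$ having contraction ratio $r_i\in(0,1)$, and let $K$ be its self-similar set, i.e. the unique non-empty compact set with $K=\bigcup_{i=1}^N S_i(K)$. Let $\Sigma=\{1,\dots,N\}$ and let $\Sigma^*$ be the set of finite words over $\Sigma$, including the empty word $\vartheta$. For $x=i_1\cdots i_k\in\Sigma^*$ put $S_x=S_{i_1}\circ\cdots\circ S_{i_k}$ and $r_x=r_{i_1}\cdots r_{i_k}$. Let $r=\min_i r_i$, $X_0=\{\vartheta\}$, $X_n=\{x=i_1\cdots i_k\in\Sigma^*: r_x\le r^n<r_{i_1}\cdots r_{i_{k-1}}\}$ for $n\ge1$, and $X=\bigcup_{n\ge0}X_n$. If $x\in X_n$ write $|x|=n$ (level $n$). For each $y\in X_n$, $n\ge1$,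 there is a unique $x\in X_{n-1}$ that is a prefix of $y$; $x$ is the parent of $y$ (and $y$ a child, or offspring, of $x$), and $\mathcal E_v$ is the (symmetric) set of all edges joining a vertex to its parent. Fix a constant $\kappa>0$ and let $\mathcal E_h=\{(x,y)\in X\times X: |x|=|y|,\ x\ne y,\ \mathrm{dist}(S_x(K),S_y(K))\le\kappa r^{|x|}\}$. Set $\mathcal E=\mathcal E_v\cup\mathcal E_h$. The graph $(X,\mathcal E)$ with root $\vartheta$ is the augmented tree of the IFS; $(X,\mathcal E_v)$ is a tree. **Simple; incidence matrices.** An $X_n$-horizontal component is a maximal subset $T\subset X_n$ connected with respect to $\mathcal E_h$; $\mathcal F$ is the set of all horizontal components, over all $n\ge0$. For $T\subset X_n$, $T_{\mathcal D}$ is the union of $T$ and all its descendants, with the edges of $\mathcal E$ restricted to it. $T,T'\in\mathcal F$ are equivalent ($T\sim T'$) if there is a graph isomorphism $T_{\mathcal D}\to T'_{\mathcal D}$ that, together with its inverse, preserves vertical edges (as parent–child relations) and horizontal edges. $(X,\mathcal E)$ is simple if $\mathcal F/\!\sim$ is finite. In that case let $[T_1],\dots,[T_m]$ be the classes; the incidence matrix of $(X,\mathcal E)$ is $A=[a_{ij}]_{m\times m}$, where $a_{ij}$ is the number of horizontal components consisting of offspring of $T\in[T_i]$ that belong to $[T_j]$. Similarly, vertices $x,y\in X$ are equivalent in $(X,\mathcal E_v)$ if the subtrees formed by $x$ and its descendants and by $y$ and its descendants are isomorphic (preserving the parent–child relation); the tree is simple if there are finitely many classes of vertices $[\mathbf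 t_1],\dots,[\mathbf t_n]$, ordered with $\vartheta\in[\mathbf t_1]$, and its incidence matrix is $B=[b_{ij}]_{n\times n}$, $b_{ij}$ being the number of offspring of a vertex in $[\mathbf t_i]$ that belong to $[\mathbf t_j]$. If $(X,\mathcal E)$ is simple, so is $(X,\mathcal E_v)$. For $T\in[T_i]$ let $u_{ij}$ be the number of vertices of $T$ in $[\mathbf t_j]$, $\mathbf u_i=[u_{i1},\dots,u_{in}]$, and $\mathbf u=[\mathbf u_1,\dots,\mathbf u_m]$. **Rearrangeable.** Let $B$ be an $n\times n$ nonnegative integer matrix with rows $\mathbf b_1,\dots,\mathbf b_n$, and $\mathbf u=[\mathbf u_1,\dots,\mathbf u_m]$ with $\mathbf u_i=[u_{i1},\dots,u_{in}]$ a vector of nonnegative integers. An $m\times m$ matrix $A$ with rows $\mathbf a_1,\dots,\mathbf a_m$ is $(B,\mathbf u)$-rearrangeable if for each $i$ there is a nonnegative integer matrix $C=[c_{sj}]_{p\times m}$, $p=\sum_{j=1}^n u_{ij}$, such that $\mathbf a_i=\mathbf 1C$ (i.e. $\mathbf a_i$ is the sum of the rows of $C$) and, putting $\mathbf c_s=\sum_{j=1}^m c_{sj}\mathbf u_j$ for $1\le s\le p$, the list $\mathbf c_1,\dots,\mathbf c_p$ consists of exactly $u_{ij}$ terms assigned the value $\mathbf b_j$ for each $j=1,\dots,n$ (condition: $\#\{\mathbf c_k:\mathbf c_k=\mathbf b_j,\ k=1,\dots,p\}=u_{ij}$). **Hyperbolicity, near-isometry.** For a connected graph with root $\vartheta$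 and graph distance $d$, let $|x|=d(\vartheta,x)$ and $|x\wedge y|=\frac12(|x|+|y|-d(x,y))$. The graph is hyperbolic if there is $\delta\ge0$ with $|x\wedge y|\ge\min\{|x\wedge z|,|z\wedge y|\}-\delta$ for all $x,y,z$. It is known that $(X,\mathcal E)$ is hyperbolic; trees are hyperbolic with $\delta=0$. For $a>0$ let $\rho_a(x,x)=0$ and $\rho_a(x,y)=\exp(-a|x\wedge y|)$ for $x\ne y$; for $a$ small ($\exp(3\delta a)<\sqrt2$) $\rho_a$ is equivalent (up to multiplicative constants) to a metric, and is called a visual metric. The hyperbolic boundary is $\partial X=\overline X\setminus X$, where $\overline X$ is the $\rho_a$-completion, equipped with the extension of $\rho_a$ (defined up to bi-Lipschitz equivalence). The same parameter $a$ is used for both graphs. A near-isometry between connected graphs $X,Y$ is a bijection $\sigma:X\to Y$ of vertex sets for which there is $L>0$ with $|d(\sigma(x),\sigma(y))-d(x,y)|<L$ for all $x,y\in X$. Two metric spaces are Lipschitz equivalent, $\simeq$, if there is a bi-Lipschitz bijection between them. *)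

theory Defs
  imports "HOL-Analysis.Analysis" "HOL-Library.Sublist"
begin

section \<open>Rooted graphs, near-isometries and hyperbolicity\<close>

text \<open>A graph is given by its vertex set and its symmetric edge relation.\<close>

definition graph_dist :: "('v \<times> 'v) set \<Rightarrow> 'v \<Rightarrow> 'v \<Rightarrow> nat" where
  "graph_dist E x y = (LEAST k. (x, y) \<in> E ^^ k)"

definition near_isometry ::
  "'v set \<Rightarrow> ('v \<times> 'v) set \<Rightarrow> 'w set \<Rightarrow> ('w \<times> 'w) set \<Rightarrow> ('v \<Rightarrow> 'w) \<Rightarrow> bool" where
  "near_isometry V E V' E' \<sigma> \<longleftrightarrow>
     bij_betw \<sigma> V V' \<and>
     (\<exists>L>0. \<forall>x\<in>V. \<forall>y\<in>V.
        \<bar>real (graph_dist E' (\<sigma> x) (\<sigma> y)) - real (graph_dist E x y)\<bar> < L)"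

definition gromov_product :: "('v \<times> 'v) set \<Rightarrow> 'v \<Rightarrow> 'v \<Rightarrow> 'v \<Rightarrow> real" where
  "gromov_product E v0 x y =
     (real (graph_dist E v0 x) + real (graph_dist E v0 y) - real (graph_dist E x y)) / 2"

definition gromov_hyperbolic :: "'v set \<Rightarrow> ('v \<times> 'v) set \<Rightarrow> 'v \<Rightarrow> real \<Rightarrow> bool" where
  "gromov_hyperbolic V E v0 \<delta> \<longleftrightarrow> \<delta> \<ge> 0 \<and>
     (\<forall>x\<in>V. \<forall>y\<in>V. \<forall>z\<in>V.
        gromov_product E v0 x y \<ge> min (gromov_product E v0 x z) (gromov_product E v0 z y) - \<delta>)"

definition visual_rho :: "('v \<times> 'v) set \<Rightarrow> 'v \<Rightarrow> real \<Rightarrow> 'v \<Rightarrow> 'v \<Rightarrow> real" where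
  "visual_rho E v0 a x y = (if x = y then 0 else exp (- a * gromov_product E v0 x y))"


section \<open>Completion with respect to a distance function\<close>

text \<open>
  The function \<open>visual_rho\<close> is in general only equivalent to a metric, up to multiplicative
  constants, so the metric-space notions of the library do not apply to it directly.  The completion
  is the usual one, by Cauchy sequences modulo sequences at vanishing distance.
\<close>

definition dist_Cauchy :: "'v set \<Rightarrow> ('v \<Rightarrow> 'v \<Rightarrow> real) \<Rightarrow> (nat \<Rightarrow> 'v) \<Rightarrow> bool" where
  "dist_Cauchy V \<rho> f \<longleftrightarrow> range f \<subseteq> V \<and>
     (\<forall>\<epsilon>>0. \<exists>M. \<forall>m\<ge>M. \<forall>n\<ge>M. \<rho> (f m) (f n) < \<epsilon>)"

definition Cauchy_equiv ::
  "'v set \<Rightarrow> ('v \<Rightarrow> 'v \<Rightarrow> real) \<Rightarrow> ((nat \<Rightarrow> 'v) \<times> (nat \<Rightarrow> 'v)) set" where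
  "Cauchy_equiv V \<rho> =
     {(f, g). dist_Cauchy V \<rho> f \<and> dist_Cauchy V \<rho> g \<and> (\<lambda>n. \<rho> (f n) (g n)) \<longlonglongrightarrow> 0}"

definition dist_completion :: "'v set \<Rightarrow> ('v \<Rightarrow> 'v \<Rightarrow> real) \<Rightarrow> (nat \<Rightarrow> 'v) set set" where
  "dist_completion V \<rho> = {f. dist_Cauchy V \<rho> f} // Cauchy_equiv V \<rho>"

definition completion_point ::
  "'v set \<Rightarrow> ('v \<Rightarrow> 'v \<Rightarrow> real) \<Rightarrow> 'v \<Rightarrow> (nat \<Rightarrow> 'v) set" where
  "completion_point V \<rho> x = Cauchy_equiv V \<rho> `` {\<lambda>_. x}"

text \<open>
  Since \<open>visual_rho\<close> need not be continuous, \<open>\<rho> (f n) (g n)\<close> need not converge for representatives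
  of two points of the completion.  For \<open>visual_rho\<close> of a hyperbolic graph, however, any two choices
  of representatives and of cluster values differ by a bounded factor, so the following convention
  is one of the extensions that agree up to bi-Lipschitz equivalence.
\<close>

definition dist_extension ::
  "('v \<Rightarrow> 'v \<Rightarrow> real) \<Rightarrow> (nat \<Rightarrow> 'v) set \<Rightarrow> (nat \<Rightarrow> 'v) set \<Rightarrow> real" where
  "dist_extension \<rho> \<xi> \<eta> =
     Inf {real_of_ereal (limsup (\<lambda>n. ereal (\<rho> (f n) (g n)))) | f g. f \<in> \<xi> \<and> g \<in> \<eta>}"

definition hyperbolic_boundary ::
  "'v set \<Rightarrow> ('v \<times> 'v) set \<Rightarrow> 'v \<Rightarrow> real \<Rightarrow> (nat \<Rightarrow> 'v) set set" where
  "hyperbolic_boundary V E v0 a =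
     dist_completion V (visual_rho E v0 a) - completion_point V (visual_rho E v0 a) ` V"

definition boundary_dist ::
  "('v \<times> 'v) set \<Rightarrow> 'v \<Rightarrow> real \<Rightarrow> (nat \<Rightarrow> 'v) set \<Rightarrow> (nat \<Rightarrow> 'v) set \<Rightarrow> real" where
  "boundary_dist E v0 a = dist_extension (visual_rho E v0 a)"

definition lipschitz_equivalent ::
  "'a set \<Rightarrow> ('a \<Rightarrow> 'a \<Rightarrow> real) \<Rightarrow> 'b set \<Rightarrow> ('b \<Rightarrow> 'b \<Rightarrow> real) \<Rightarrow> bool" where
  "lipschitz_equivalent M d M' d' \<longleftrightarrow>
     (\<exists>\<phi> c. bij_betw \<phi> M M' \<and> c \<ge> 1 \<and>
        (\<forall>x\<in>M. \<forall>y\<in>M. d x y / c \<le> d' (\<phi> x) (\<phi> y) \<and> d' (\<phi> x) (\<phi> y) \<le> c * d x y))"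


section \<open>Rearrangeable matrices\<close>

text \<open>
  Matrices have natural number entries and indices starting at 1: \<open>A\<close> is \<open>m \<times> m\<close>, \<open>B\<close> is
  \<open>n \<times> n\<close>, and \<open>u i\<close> is the \<open>i\<close>-th vector (of length \<open>n\<close>) of the representation, \<open>1 \<le> i \<le> m\<close>.
  The function \<open>\<phi>\<close> is the assignment of a row of \<open>B\<close> to each term \<open>c\<^sub>s\<close>.
\<close>

definition rearrangeable ::
  "nat \<Rightarrow> nat \<Rightarrow> (nat \<Rightarrow> nat \<Rightarrow> nat) \<Rightarrow> (nat \<Rightarrow> nat \<Rightarrow> nat) \<Rightarrow> (nat \<Rightarrow> nat \<Rightarrow> nat) \<Rightarrow> bool" where
  "rearrangeable m n B u A \<longleftrightarrow>
     (\<forall>i\<in>{1..m}. \<exists>(C :: nat \<Rightarrow> nat \<Rightarrow> nat) (\<phi> :: nat \<Rightarrow> nat).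
        let p = (\<Sum>j=1..n. u i j) in
          (\<forall>j\<in>{1..m}. A i j = (\<Sum>s=1..p. C s j)) \<and>
          (\<forall>s\<in>{1..p}. \<phi> s \<in> {1..n} \<and>
             (\<forall>l\<in>{1..n}. (\<Sum>j=1..m. C s j * u j l) = B (\<phi> s) l)) \<and>
          (\<forall>j\<in>{1..n}. card {s \<in> {1..p}. \<phi> s = j} = u i j))"


section \<open>The augmented tree of an iterated function system\<close>

text \<open>The hypotheses on \<open>K\<close> determine it uniquely: it is the self-similar set of the system.\<close>

locale augmented_tree =
  fixes N :: nat
    and S :: "nat \<Rightarrow> real ^ 'd \<Rightarrow> real ^ 'd"
    and ratio :: "nat \<Rightarrow> real"
    and K :: "(real ^ 'd) set"
    and kappa :: real
  assumes N_ge_1: "N \<ge> 1"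
    and ratio_pos: "i \<in> {1..N} \<Longrightarrow> ratio i > 0"
    and ratio_less_1: "i \<in> {1..N} \<Longrightarrow> ratio i < 1"
    and similitude: "i \<in> {1..N} \<Longrightarrow> dist (S i z) (S i w) = ratio i * dist z w"
    and compact_K: "compact K"
    and K_nonempty: "K \<noteq> {}"
    and K_invariant: "K = (\<Union>i\<in>{1..N}. S i ` K)"
    and kappa_pos: "kappa > 0"
begin

definition min_ratio :: real where
  "min_ratio = Min (ratio ` {1..N})"

definition word_ratio :: "nat list \<Rightarrow> real" where
  "word_ratio x = prod_list (map ratio x)"

definition word_map :: "nat list \<Rightarrow> real ^ 'd \<Rightarrow> real ^ 'd" where
  "word_map x = foldr (\<lambda>i f. S i \<circ> f) x id"

definition level :: "nat \<Rightarrow> nat list set" where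
  "level n = (if n = 0 then {[]} else
     {x. x \<noteq> [] \<and> set x \<subseteq> {1..N} \<and>
         word_ratio x \<le> min_ratio ^ n \<and> min_ratio ^ n < word_ratio (butlast x)})"

definition vertices :: "nat list set" where
  "vertices = (\<Union>n. level n)"

text \<open>Pairs (parent, child).\<close>

definition parent_rel :: "(nat list \<times> nat list) set" where
  "parent_rel = {(x, y). \<exists>n. x \<in> level n \<and> y \<in> level (Suc n) \<and> prefix x y}"

definition vertical_edges :: "(nat list \<times> nat list) set" where
  "vertical_edges = parent_rel \<union> parent_rel\<inverse>"

definition horizontal_edges :: "(nat list \<times> nat list) set" where
  "horizontal_edges = {(x, y). \<exists>n. x \<in> level n \<and> y \<in> level n \<and> x \<noteq> y \<and>
     setdist (word_map x ` K) (word_map y ` K) \<le> kappa * min_ratio ^ n}"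

definition edges :: "(nat list \<times> nat list) set" where
  "edges = vertical_edges \<union> horizontal_edges"

definition horizontally_connected :: "nat list set \<Rightarrow> bool" where
  "horizontally_connected T \<longleftrightarrow>
     (\<forall>x\<in>T. \<forall>y\<in>T. (x, y) \<in> (horizontal_edges \<inter> T \<times> T)\<^sup>*)"

definition horizontal_components :: "nat list set set" where
  "horizontal_components = {T. \<exists>n. T \<noteq> {} \<and> T \<subseteq> level n \<and> horizontally_connected T \<and>
     (\<forall>T'. T \<subseteq> T' \<and> T' \<subseteq> level n \<and> horizontally_connected T' \<longrightarrow> T' = T)}"

text \<open>\<open>T\<close> together with all its descendants.\<close>

definition descendants :: "nat list set \<Rightarrow> nat list set" where
  "descendants T = parent_rel\<^sup>* `` T"

definition component_equiv :: "(nat list set \<times> nat list set) set" where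
  "component_equiv = {(T, T'). T \<in> horizontal_components \<and> T' \<in> horizontal_components \<and>
     (\<exists>\<sigma>. bij_betw \<sigma> (descendants T) (descendants T') \<and>
        (\<forall>x\<in>descendants T. \<forall>y\<in>descendants T.
           ((\<sigma> x, \<sigma> y) \<in> parent_rel \<longleftrightarrow> (x, y) \<in> parent_rel) \<and>
           ((\<sigma> x, \<sigma> y) \<in> horizontal_edges \<longleftrightarrow> (x, y) \<in> horizontal_edges)))}"

definition vertex_equiv :: "(nat list \<times> nat list) set" where
  "vertex_equiv = {(x, y). x \<in> vertices \<and> y \<in> vertices \<and>
     (\<exists>\<sigma>. bij_betw \<sigma> (descendants {x}) (descendants {y}) \<and>
        (\<forall>z\<in>descendants {x}. \<forall>w\<in>descendants {x}.
           (\<sigma> z, \<sigma> w) \<in> parent_rel \<longleftrightarrow> (z, w) \<in> parent_rel))}"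

definition component_classes :: "nat list set set set" where
  "component_classes = horizontal_components // component_equiv"

definition vertex_classes :: "nat list set set" where
  "vertex_classes = vertices // vertex_equiv"

definition simple_augmented_tree :: bool where
  "simple_augmented_tree \<longleftrightarrow> finite component_classes"

text \<open>
  In the next three definitions \<open>Tc\<close> enumerates the classes of horizontal components and \<open>tc\<close> the
  classes of vertices.  The numbers do not depend on the choice of representatives: isomorphisms
  preserve horizontal components of offspring and classes of vertices.
\<close>

definition component_incidence :: "(nat \<Rightarrow> nat list set set) \<Rightarrow> nat \<Rightarrow> nat \<Rightarrow> nat" where
  "component_incidence Tc i j = card {T' \<in> Tc j. T' \<subseteq> parent_rel `` (SOME T. T \<in> Tc i)}"

definition vertex_incidence :: "(nat \<Rightarrow> nat list set) \<Rightarrow> nat \<Rightarrow> nat \<Rightarrow> nat" where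
  "vertex_incidence tc i j = card {y \<in> tc j. (SOME x. x \<in> tc i, y) \<in> parent_rel}"

definition class_representation ::
  "(nat \<Rightarrow> nat list set set) \<Rightarrow> (nat \<Rightarrow> nat list set) \<Rightarrow> nat \<Rightarrow> nat \<Rightarrow> nat" where
  "class_representation Tc tc i j = card {x \<in> (SOME T. T \<in> Tc i). x \<in> tc j}"

end

end

theory Submission
  imports Defs
begin

text \<open>
  The idea is to change the tree before comparing it with the augmented tree.  Rearrangeability
  says that, for a horizontal component \<open>T\<close>, the components formed by the children of \<open>T\<close> can be
  distributed over the vertices of \<open>T\<close> so that every vertex receives, class by class, as many
  vertices as it has children.  Declaring the vertex to which the component of \<open>z\<close> is assigned to
  be the new parent of \<open>z\<close> yields a second tree on the same vertices (\<open>rearranged_parent\<close>).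

  On the one hand, the number of children of each class in the new tree depends only on the class
  of a vertex, and is the same as in the old tree.  Hence the two trees are isomorphic, by an
  isomorphism \<open>\<sigma>\<close> that is built level by level (\<open>ex_level_bijections\<close>).

  On the other hand, the new tree is close to the augmented tree.  Old and new ancestors of a
  vertex lie in the same component, and the vertices of a component are siblings in the new tree.
  In both graphs the distance of \<open>x\<close> and \<open>y\<close> is governed by the deepest level \<open>k\<close> at which their
  ancestors agree, as vertices in the new tree and up to components in the augmented tree: a path
  has to climb to a level at which they agree (\<open>path_meet\<close>), and conversely one can climb to
  level \<open>k\<close> and cross over at bounded cost, since a simple augmented tree has components of bounded
  size.  The two levels differ by at most one, so \<open>\<sigma>\<close> is a near-isometry (\<open>ex_near_isometry\<close>).

  A near-isometry changes Gromov products by a bounded amount and therefore the visual distance by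
  a bounded factor.  Composition with it maps Cauchy sequences to Cauchy sequences and
  induces a bi-Lipschitz bijection of the boundaries (\<open>lipschitz_equivalent_boundary\<close>).
\<close>

section \<open>Matching functions with equal fibre sizes\<close>

text \<open>
  Equalities between numbers of vertices of each class enter the construction only through this
  lemma: they provide bijections that respect the classes.
\<close>

lemma ex_bij_betw_same_fibres:
  assumes "finite A" and "finite B"
    and card: "\<And>k. card {a \<in> A. \<alpha> a = k} = card {b \<in> B. \<beta> b = k}"
  shows "\<exists>g. bij_betw g A B \<and> (\<forall>a\<in>A. \<beta> (g a) = \<alpha> a)"
proof -
  have "\<forall>k. \<exists>g. bij_betw g {a \<in> A. \<alpha> a = k} {b \<in> B. \<beta> b = k}"
    using assms by (intro allI finite_same_card_bij) auto
  then obtain G where G: "\<And>k. bij_betw (G k) {a \<in> A. \<alpha> a = k} {b \<in> B. \<beta> b = k}"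
    by metis
  define g where "g a = G (\<alpha> a) a" for a
  have g: "g a \<in> B \<and> \<beta> (g a) = \<alpha> a" if "a \<in> A" for a
    using bij_betwE[OF G[of "\<alpha> a"]] that by (auto simp: g_def)
  have "inj_on g A"
  proof (rule inj_onI)
    fix a a' assume *: "a \<in> A" "a' \<in> A" "g a = g a'"
    then have "\<alpha> a = \<alpha> a'" using g by metis
    with * show "a = a'"
      using bij_betw_imp_inj_on[OF G[of "\<alpha> a"]] by (auto simp: g_def inj_on_def)
  qed
  moreover have "g ` A = B"
  proof (intro equalityI subsetI)
    fix b assume "b \<in> B"
    then have "b \<in> G (\<beta> b) ` {a \<in> A. \<alpha> a = \<beta> b}"
      using bij_betw_imp_surj_on[OF G[of "\<beta> b"]] by simp
    then obtain a where "a \<in> A" "\<alpha> a = \<beta> b" "b = G (\<beta> b) a" by blast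
    then have "b = g a" by (simp add: g_def)
    then show "b \<in> g ` A" using \<open>a \<in> A\<close> by simp
  qed (use g in auto)
  ultimately show ?thesis using g by (auto simp: bij_betw_def)
qed

text \<open>
  Read with the columns of a matrix \<open>C\<close> as \<open>c\<close>, this turns the numerical decomposition of a row
  of \<open>A\<close> into an actual distribution of components into groups.
\<close>

lemma ex_function_with_fibre_cards:
  fixes c :: "'s \<Rightarrow> nat"
  assumes "finite A" and "finite S" and card: "card A = (\<Sum>s\<in>S. c s)"
  shows "\<exists>q. (\<forall>a\<in>A. q a \<in> S) \<and> (\<forall>s\<in>S. card {a \<in> A. q a = s} = c s)"
proof -
  have "card (SIGMA s:S. {..<c s}) = card A"
    using assms by (simp add: card_SigmaI)
  then obtain G where G: "bij_betw G A (SIGMA s:S. {..<c s})"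
    using finite_same_card_bij[of A "SIGMA s:S. {..<c s}"] assms by auto
  have "card {a \<in> A. fst (G a) = s} = c s" if "s \<in> S" for s
  proof -
    have "G ` {a \<in> A. fst (G a) = s} = {s} \<times> {..<c s}"
    proof (intro equalityI subsetI)
      fix y assume y: "y \<in> {s} \<times> {..<c s}"
      then have "y \<in> G ` A" using bij_betw_imp_surj_on[OF G] that by auto
      then obtain x where "x \<in> A" "y = G x" by blast
      moreover from this have "fst (G x) = s" using y by auto
      ultimately show "y \<in> G ` {a \<in> A. fst (G a) = s}" by blast
    qed (use bij_betwE[OF G] in fastforce)
    then have "bij_betw G {a \<in> A. fst (G a) = s} ({s} \<times> {..<c s})"
      using bij_betw_imp_inj_on[OF G] by (auto simp: bij_betw_def intro: inj_on_subset)
    then show ?thesis by (auto dest!: bij_betw_same_card simp: card_cartesian_product)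
  qed
  moreover have "fst (G a) \<in> S" if "a \<in> A" for a
    using bij_betwE[OF G] that by auto
  ultimately show ?thesis by (intro exI[of _ "\<lambda>a. fst (G a)"]) auto
qed

section \<open>Paths in rooted graphs\<close>

lemma graph_dist_le: "(x, y) \<in> E ^^ k \<Longrightarrow> graph_dist E x y \<le> k"
  unfolding graph_dist_def by (rule Least_le)

lemma graph_dist_path:
  assumes "(x, y) \<in> E\<^sup>*"
  shows "(x, y) \<in> E ^^ graph_dist E x y"
  using assms unfolding graph_dist_def by (metis LeastI_ex rtrancl_power)

lemma graph_dist_triangle:
  assumes "(x, y) \<in> E\<^sup>*" "(y, z) \<in> E\<^sup>*"
  shows "graph_dist E x z \<le> graph_dist E x y + graph_dist E y z"
  using graph_dist_path[OF assms(1)] graph_dist_path[OF assms(2)]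
  by (intro graph_dist_le) (auto simp: relpow_add)

lemma relpow_sym:
  assumes "sym E" and "(x, y) \<in> E ^^ k"
  shows "(y, x) \<in> E ^^ k"
  using assms(2)
proof (induction k arbitrary: y)
  case (Suc k)
  then obtain w where "(x, w) \<in> E ^^ k" "(w, y) \<in> E" by auto
  then show ?case using Suc.IH symD[OF assms(1)] by (metis relpow_Suc_I2)
qed simp

lemma graph_dist_sym: "sym E \<Longrightarrow> graph_dist E x y = graph_dist E y x"
  unfolding graph_dist_def by (rule arg_cong[of _ _ Least]) (auto intro: relpow_sym)

lemma relpow_mono:
  fixes R R' :: "('v \<times> 'v) set"
  assumes "R \<subseteq> R'"
  shows "R ^^ k \<subseteq> R' ^^ k"
proof (induction k)
  case (Suc k)
  then show ?case using assms by auto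
qed simp

text \<open>
  Here \<open>P k x\<close> stands for the ancestor of \<open>x\<close> at level \<open>k\<close>, or for its component.  Let \<open>k\<close> be
  the smallest level that a path visits.  None of its steps changes the ancestors at the levels up
  to \<open>k\<close>, and as levels change by at most one per step, the path needs \<open>lev x - k\<close> steps to get down
  to level \<open>k\<close> and \<open>lev y - k\<close> steps to return.
\<close>

lemma path_meet:
  fixes lev :: "'v \<Rightarrow> nat" and P :: "nat \<Rightarrow> 'v \<Rightarrow> 'c"
  assumes edge: "\<And>x y. (x, y) \<in> E \<Longrightarrow> lev y \<le> Suc (lev x) \<and> lev x \<le> Suc (lev y)"
    and same: "\<And>x y k. (x, y) \<in> E \<Longrightarrow> k \<le> lev x \<Longrightarrow> k \<le> lev y \<Longrightarrow> P k x = P k y"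
    and path: "(x, y) \<in> E ^^ l"
  shows "\<exists>k. k \<le> lev x \<and> k \<le> lev y \<and> (\<forall>i\<le>k. P i x = P i y) \<and> lev x + lev y \<le> l + 2 * k"
  using path
proof (induction l arbitrary: y)
  case 0
  then show ?case by (intro exI[of _ "lev x"]) auto
next
  case (Suc l)
  then obtain z where z: "(x, z) \<in> E ^^ l" "(z, y) \<in> E" by auto
  from Suc.IH[OF z(1)] obtain k where k: "k \<le> lev x" "k \<le> lev z" "\<forall>i\<le>k. P i x = P i z"
    "lev x + lev z \<le> l + 2 * k" by auto
  have "lev y \<le> Suc (lev z)" "lev z \<le> Suc (lev y)" using edge[OF z(2)] by auto
  moreover have "\<forall>i\<le>min k (lev y). P i x = P i y" using k same[OF z(2)] by auto
  ultimately show ?case using k by (intro exI[of _ "min k (lev y)"]) auto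
qed

section \<open>Near-isometries and hyperbolic boundaries\<close>

lemma gromov_product_nonneg:
  assumes "sym E" "(v0, x) \<in> E\<^sup>*" "(v0, y) \<in> E\<^sup>*"
  shows "gromov_product E v0 x y \<ge> 0"
proof -
  have "graph_dist E x y \<le> graph_dist E x v0 + graph_dist E v0 y"
    using assms by (intro graph_dist_triangle) (auto intro: symD[OF sym_rtrancl])
  then show ?thesis
    unfolding gromov_product_def graph_dist_sym[OF \<open>sym E\<close>, of x v0] by auto
qed

text \<open>
  The image of the root is at a fixed distance \<open>D\<close> from the other root, so distances to the roots
  also change by a bounded amount; hence so do Gromov products, and \<open>exp\<close> turns the additive
  error into a factor.
\<close>

lemma near_isometry_visual_rho:
  assumes "near_isometry V E V' E' \<sigma>"
    and E: "sym E" "\<And>x y. x \<in> V \<Longrightarrow> y \<in> V \<Longrightarrow> (x, y) \<in> E\<^sup>*" "v0 \<in> V"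
    and E': "sym E'" "\<And>x y. x \<in> V' \<Longrightarrow> y \<in> V' \<Longrightarrow> (x, y) \<in> E'\<^sup>*" "v0' \<in> V'"
    and a: "a > 0"
  shows "\<exists>c\<ge>1. \<forall>x\<in>V. \<forall>y\<in>V.
    visual_rho E' v0' a (\<sigma> x) (\<sigma> y) \<le> c * visual_rho E v0 a x y \<and>
    visual_rho E v0 a x y \<le> c * visual_rho E' v0' a (\<sigma> x) (\<sigma> y)"
proof -
  from assms(1) obtain L where \<sigma>: "bij_betw \<sigma> V V'" and "L > 0"
    and L: "\<And>x y. x \<in> V \<Longrightarrow> y \<in> V \<Longrightarrow>
      \<bar>real (graph_dist E' (\<sigma> x) (\<sigma> y)) - real (graph_dist E x y)\<bar> < L"
    unfolding near_isometry_def by auto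
  have \<sigma>V: "\<sigma> x \<in> V'" if "x \<in> V" for x using bij_betwE[OF \<sigma>] that by auto
  define D where "D = real (graph_dist E' v0' (\<sigma> v0))"
  have root: "\<bar>real (graph_dist E' v0' (\<sigma> x)) - real (graph_dist E v0 x)\<bar> \<le> L + D" if "x \<in> V" for x
  proof -
    have "graph_dist E' v0' (\<sigma> x) \<le> graph_dist E' v0' (\<sigma> v0) + graph_dist E' (\<sigma> v0) (\<sigma> x)"
      "graph_dist E' (\<sigma> v0) (\<sigma> x) \<le> graph_dist E' (\<sigma> v0) v0' + graph_dist E' v0' (\<sigma> x)"
      using that E E' \<sigma>V by (auto intro!: graph_dist_triangle)
    then show ?thesis
      using L[OF \<open>v0 \<in> V\<close> that] graph_dist_sym[OF E'(1), of "\<sigma> v0" v0'] unfolding D_def by linarith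
  qed
  define M where "M = (3 * L + 2 * D) / 2"
  have gp: "\<bar>gromov_product E' v0' (\<sigma> x) (\<sigma> y) - gromov_product E v0 x y\<bar> \<le> M"
    if "x \<in> V" "y \<in> V" for x y
    using root[OF that(1)] root[OF that(2)] L[OF that]
    unfolding M_def gromov_product_def by (simp add: field_simps abs_le_iff) linarith
  have inj: "\<sigma> x = \<sigma> y \<longleftrightarrow> x = y" if "x \<in> V" "y \<in> V" for x y
    using \<sigma> that by (auto simp: bij_betw_def inj_on_def)
  have exp_le: "exp (- a * s) \<le> exp (a * M) * exp (- a * t)" if "t - s \<le> M" for s t
  proof -
    have "a * (t - s) \<le> a * M" using that a by (intro mult_left_mono) auto
    then have "- a * s \<le> a * M + - a * t" by (simp add: algebra_simps)
    then show ?thesis unfolding mult_exp_exp by simp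
  qed
  have "M \<ge> 0" unfolding M_def D_def using \<open>L > 0\<close> by simp
  then have "exp (a * M) \<ge> 1" using a by simp
  then show ?thesis
  proof (intro exI[of _ "exp (a * M)"] conjI ballI)
    fix x y assume xy: "x \<in> V" "y \<in> V"
    show "visual_rho E' v0' a (\<sigma> x) (\<sigma> y) \<le> exp (a * M) * visual_rho E v0 a x y"
      "visual_rho E v0 a x y \<le> exp (a * M) * visual_rho E' v0' a (\<sigma> x) (\<sigma> y)"
      using gp[OF xy] inj[OF xy] exp_le[of "gromov_product E v0 x y" "gromov_product E' v0' (\<sigma> x) (\<sigma> y)"]
        exp_le[of "gromov_product E' v0' (\<sigma> x) (\<sigma> y)" "gromov_product E v0 x y"]
      by (auto simp: visual_rho_def abs_le_iff)
  qed
qed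

lemma dist_Cauchy_comparable:
  assumes \<sigma>: "\<sigma> ` V \<subseteq> V'" and "c \<ge> 1"
    and le: "\<And>x y. x \<in> V \<Longrightarrow> y \<in> V \<Longrightarrow> \<rho>' (\<sigma> x) (\<sigma> y) \<le> c * \<rho> x y"
    and f: "dist_Cauchy V \<rho> f"
  shows "dist_Cauchy V' \<rho>' (\<sigma> \<circ> f)"
  unfolding dist_Cauchy_def
proof (intro conjI allI impI)
  have V: "range f \<subseteq> V" using f by (simp add: dist_Cauchy_def)
  then show "range (\<sigma> \<circ> f) \<subseteq> V'" using \<sigma> by auto
  fix \<epsilon> :: real assume "\<epsilon> > 0"
  then have "\<epsilon> / c > 0" using \<open>c \<ge> 1\<close> by simp
  then obtain M where M: "\<forall>m\<ge>M. \<forall>n\<ge>M. \<rho> (f m) (f n) < \<epsilon> / c"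
    using f unfolding dist_Cauchy_def by blast
  have "\<rho>' (\<sigma> (f m)) (\<sigma> (f n)) < \<epsilon>" if "m \<ge> M" "n \<ge> M" for m n
  proof -
    have "\<rho>' (\<sigma> (f m)) (\<sigma> (f n)) \<le> c * \<rho> (f m) (f n)" using V by (intro le) auto
    also have "\<dots> < c * (\<epsilon> / c)" using M that \<open>c \<ge> 1\<close> by (intro mult_strict_left_mono) auto
    finally show ?thesis using \<open>c \<ge> 1\<close> by simp
  qed
  then show "\<exists>M. \<forall>m\<ge>M. \<forall>n\<ge>M. \<rho>' ((\<sigma> \<circ> f) m) ((\<sigma> \<circ> f) n) < \<epsilon>" by auto
qed

lemma real_limsup_le:
  fixes u v :: "nat \<Rightarrow> real"
  assumes "\<And>k. 0 \<le> u k" "\<And>k. u k \<le> c * v k" "\<And>k. v k \<le> 1" "c \<ge> 0" "\<And>k. 0 \<le> v k"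
  shows "real_of_ereal (limsup (\<lambda>k. ereal (u k))) \<le> c * real_of_ereal (limsup (\<lambda>k. ereal (v k)))"
proof -
  have le1: "limsup (\<lambda>k. ereal (v k)) \<le> 1"
    using assms(3) by (intro Limsup_bounded) auto
  have ge0: "0 \<le> limsup (\<lambda>k. ereal (v k))"
    using assms(5) by (intro le_Limsup) auto
  obtain L where L: "limsup (\<lambda>k. ereal (v k)) = ereal L" "0 \<le> L"
    using le1 ge0 by (cases "limsup (\<lambda>k. ereal (v k))") auto
  have "limsup (\<lambda>k. ereal (u k)) \<le> limsup (\<lambda>k. ereal c * ereal (v k))"
    using assms(2) by (intro Limsup_mono) auto
  also have "\<dots> = ereal c * limsup (\<lambda>k. ereal (v k))"
    using assms(4) by (intro Limsup_ereal_mult_left) auto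
  finally have "limsup (\<lambda>k. ereal (u k)) \<le> ereal (c * L)" using L by simp
  moreover have "0 \<le> limsup (\<lambda>k. ereal (u k))"
    using assms(1) by (intro le_Limsup) auto
  ultimately show ?thesis
    using L by (cases "limsup (\<lambda>k. ereal (u k))") auto
qed

lemma real_limsup_nonneg:
  fixes v :: "nat \<Rightarrow> real"
  assumes "\<And>k. 0 \<le> v k"
  shows "0 \<le> real_of_ereal (limsup (\<lambda>k. ereal (v k)))"
proof -
  have "0 \<le> limsup (\<lambda>k. ereal (v k))"
    using assms by (intro le_Limsup) auto
  then show ?thesis by (rule real_of_ereal_pos)
qed


lemma Inf_image_comparable:
  fixes F G :: "'i \<Rightarrow> real"
  assumes "I \<noteq> {}" "c > 0" "\<And>i. i \<in> I \<Longrightarrow> 0 \<le> F i" "\<And>i. i \<in> I \<Longrightarrow> F i \<le> c * G i"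
  shows "Inf (F ` I) \<le> c * Inf (G ` I)"
proof -
  have "Inf (F ` I) / c \<le> G i" if "i \<in> I" for i
  proof -
    have "Inf (F ` I) \<le> F i"
      using that assms(3) by (intro cInf_lower bdd_belowI2[of _ 0]) auto
    also have "\<dots> \<le> c * G i" using assms(4) that by simp
    finally show ?thesis using \<open>c > 0\<close> by (simp add: field_simps)
  qed
  then have "Inf (F ` I) / c \<le> Inf (G ` I)" using \<open>I \<noteq> {}\<close> by (intro cINF_greatest) auto
  then show ?thesis using \<open>c > 0\<close> by (simp add: field_simps)
qed

text \<open>
  The boundary map is \<open>\<xi> \<mapsto> {\<sigma> \<circ> f | f \<in> \<xi>}\<close>.  Comparability of the two distance functions up to
  a factor makes it a bijection between classes of Cauchy sequences, taking constant sequences to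
  constant ones, and passes to upper limits and infima, hence to the extended distances.
\<close>

theorem lipschitz_equivalent_boundary:
  assumes near: "near_isometry V E V' E' \<sigma>"
    and E: "sym E" "\<And>x y. x \<in> V \<Longrightarrow> y \<in> V \<Longrightarrow> (x, y) \<in> E\<^sup>*" "v0 \<in> V"
    and E': "sym E'" "\<And>x y. x \<in> V' \<Longrightarrow> y \<in> V' \<Longrightarrow> (x, y) \<in> E'\<^sup>*" "v0' \<in> V'"
    and a: "a > 0"
  shows "lipschitz_equivalent
    (hyperbolic_boundary V E v0 a) (boundary_dist E v0 a)
    (hyperbolic_boundary V' E' v0' a) (boundary_dist E' v0' a)"
proof -
  define \<rho> \<rho>' where "\<rho> = visual_rho E v0 a" and "\<rho>' = visual_rho E' v0' a"
  have \<sigma>: "bij_betw \<sigma> V V'" using near unfolding near_isometry_def by simp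
  have \<sigma>V: "\<sigma> ` V = V'" using \<sigma> by (rule bij_betw_imp_surj_on)
  obtain c where c: "c \<ge> 1"
    and le: "\<And>x y. x \<in> V \<Longrightarrow> y \<in> V \<Longrightarrow> \<rho>' (\<sigma> x) (\<sigma> y) \<le> c * \<rho> x y"
    and ge: "\<And>x y. x \<in> V \<Longrightarrow> y \<in> V \<Longrightarrow> \<rho> x y \<le> c * \<rho>' (\<sigma> x) (\<sigma> y)"
    using near_isometry_visual_rho[OF near E E' a] unfolding \<rho>_def \<rho>'_def by metis
  have bounds: "0 \<le> \<rho> x y" "0 \<le> \<rho>' x' y'" for x y x' y'
    by (simp_all add: \<rho>_def \<rho>'_def visual_rho_def)
  have \<rho>1: "\<rho> x y \<le> 1" if "x \<in> V" "y \<in> V" for x y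
    using gromov_product_nonneg[of E v0 x y] E that a by (auto simp: \<rho>_def visual_rho_def)
  have \<rho>1': "\<rho>' x y \<le> 1" if "x \<in> V'" "y \<in> V'" for x y
    using gromov_product_nonneg[of E' v0' x y] E' that a by (auto simp: \<rho>'_def visual_rho_def)
  define \<tau> where "\<tau> = inv_into V \<sigma>"
  have \<tau>V: "\<tau> ` V' = V" unfolding \<tau>_def using \<sigma> by (metis bij_betw_imp_surj_on bij_betw_inv_into)
  have \<sigma>\<tau>: "\<sigma> (\<tau> y) = y" if "y \<in> V'" for y
    unfolding \<tau>_def using that \<sigma>V by (intro f_inv_into_f) auto
  have \<tau>\<sigma>: "\<tau> (\<sigma> x) = x" if "x \<in> V" for x
    unfolding \<tau>_def using that \<sigma> by (intro inv_into_f_f) (auto simp: bij_betw_def)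

  define Seq where "Seq = {f :: nat \<Rightarrow> 'a. range f \<subseteq> V}"
  have Cauchy_Seq: "f \<in> Seq" if "dist_Cauchy V \<rho> f" for f
    using that by (auto simp: dist_Cauchy_def Seq_def)
  have inj_comp: "inj_on ((\<circ>) \<sigma>) Seq"
  proof (rule inj_onI)
    fix f g assume "f \<in> Seq" "g \<in> Seq" "\<sigma> \<circ> f = \<sigma> \<circ> g"
    then have "\<tau> (\<sigma> (f k)) = \<tau> (\<sigma> (g k))" "f k \<in> V" "g k \<in> V" for k
      by (auto simp: fun_eq_iff Seq_def)
    then show "f = g" using \<tau>\<sigma> by (metis ext)
  qed
  have Cauchy_iff: "dist_Cauchy V' \<rho>' (\<sigma> \<circ> f) \<longleftrightarrow> dist_Cauchy V \<rho> f" if "f \<in> Seq" for f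
  proof
    assume "dist_Cauchy V \<rho> f"
    then show "dist_Cauchy V' \<rho>' (\<sigma> \<circ> f)"
      using \<sigma>V c le by (intro dist_Cauchy_comparable[where \<rho> = \<rho> and V = V]) simp_all
  next
    assume *: "dist_Cauchy V' \<rho>' (\<sigma> \<circ> f)"
    have "\<rho> (\<tau> x) (\<tau> y) \<le> c * \<rho>' x y" if "x \<in> V'" "y \<in> V'" for x y
      using ge[of "\<tau> x" "\<tau> y"] that \<sigma>\<tau> \<tau>V by auto
    then have "dist_Cauchy V \<rho> (\<tau> \<circ> (\<sigma> \<circ> f))"
      using \<tau>V c * by (intro dist_Cauchy_comparable[where \<rho> = \<rho>' and V = V']) simp_all
    moreover have "\<tau> \<circ> (\<sigma> \<circ> f) = f" using that \<tau>\<sigma> by (auto simp: Seq_def fun_eq_iff)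
    ultimately show "dist_Cauchy V \<rho> f" by simp
  qed
  have lim_iff: "(\<lambda>k. \<rho>' (\<sigma> (f k)) (\<sigma> (g k))) \<longlonglongrightarrow> 0 \<longleftrightarrow> (\<lambda>k. \<rho> (f k) (g k)) \<longlonglongrightarrow> 0"
    if "f \<in> Seq" "g \<in> Seq" for f g
  proof
    have V: "f k \<in> V" "g k \<in> V" for k using that by (auto simp: Seq_def)
    {
      assume "(\<lambda>k. \<rho> (f k) (g k)) \<longlonglongrightarrow> 0"
      then have "(\<lambda>k. c * \<rho> (f k) (g k)) \<longlonglongrightarrow> 0" by (rule tendsto_mult_right_zero)
      then show "(\<lambda>k. \<rho>' (\<sigma> (f k)) (\<sigma> (g k))) \<longlonglongrightarrow> 0"
        by (rule tendsto_sandwich[OF _ _ tendsto_const, rotated 2])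
          (use le V bounds in \<open>auto intro!: always_eventually\<close>)
    }
    {
      assume "(\<lambda>k. \<rho>' (\<sigma> (f k)) (\<sigma> (g k))) \<longlonglongrightarrow> 0"
      then have "(\<lambda>k. c * \<rho>' (\<sigma> (f k)) (\<sigma> (g k))) \<longlonglongrightarrow> 0" by (rule tendsto_mult_right_zero)
      then show "(\<lambda>k. \<rho> (f k) (g k)) \<longlonglongrightarrow> 0"
        by (rule tendsto_sandwich[OF _ _ tendsto_const, rotated 2])
          (use ge V bounds in \<open>auto intro!: always_eventually\<close>)
    }
  qed
  let ?r = "Cauchy_equiv V \<rho>" and ?r' = "Cauchy_equiv V' \<rho>'"
  have equiv_iff: "(\<sigma> \<circ> f, \<sigma> \<circ> g) \<in> ?r' \<longleftrightarrow> (f, g) \<in> ?r" if "f \<in> Seq" "g \<in> Seq" for f g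
    using Cauchy_iff[OF that(1)] Cauchy_iff[OF that(2)] lim_iff[OF that]
    by (auto simp: Cauchy_equiv_def)
  have lift: "\<exists>g\<in>Seq. g' = \<sigma> \<circ> g" if "range g' \<subseteq> V'" for g'
  proof -
    have "g' k \<in> V'" for k using that by auto
    then have "\<tau> \<circ> g' \<in> Seq" "g' = \<sigma> \<circ> (\<tau> \<circ> g')"
      using \<tau>V \<sigma>\<tau> by (auto simp: Seq_def fun_eq_iff) 
    then show ?thesis by blast
  qed

  define \<phi> where "\<phi> \<xi> = (\<circ>) \<sigma> ` \<xi>" for \<xi> :: "(nat \<Rightarrow> 'a) set"
  have class_Seq: "?r `` {f} \<subseteq> Seq" for f using Cauchy_Seq by (auto simp: Cauchy_equiv_def)
  have \<phi>_class: "\<phi> (?r `` {f}) = ?r' `` {\<sigma> \<circ> f}" if "f \<in> Seq" for f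
  proof (intro equalityI subsetI)
    fix g' assume g': "g' \<in> ?r' `` {\<sigma> \<circ> f}"
    then have "range g' \<subseteq> V'" by (auto simp: Cauchy_equiv_def dist_Cauchy_def)
    then obtain g where "g \<in> Seq" "g' = \<sigma> \<circ> g" using lift by blast
    then show "g' \<in> \<phi> (?r `` {f})" using g' equiv_iff[OF that] by (auto simp: \<phi>_def)
  next
    fix g' assume "g' \<in> \<phi> (?r `` {f})"
    then obtain g where g: "g' = \<sigma> \<circ> g" "(f, g) \<in> ?r" by (auto simp: \<phi>_def)
    then show "g' \<in> ?r' `` {\<sigma> \<circ> f}" using equiv_iff[OF that, of g] class_Seq[of f] by auto
  qed
  have \<phi>_completion: "\<phi> ` dist_completion V \<rho> = dist_completion V' \<rho>'"
  proof (intro equalityI subsetI)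
    fix \<xi>' assume "\<xi>' \<in> \<phi> ` dist_completion V \<rho>"
    then obtain f where f: "dist_Cauchy V \<rho> f" "\<xi>' = \<phi> (?r `` {f})"
      by (auto simp: dist_completion_def quotient_def)
    then show "\<xi>' \<in> dist_completion V' \<rho>'"
      using Cauchy_iff[of f] \<phi>_class[of f] Cauchy_Seq[of f]
      by (auto simp: dist_completion_def intro!: quotientI)
  next
    fix \<xi>' assume "\<xi>' \<in> dist_completion V' \<rho>'"
    then obtain f' where f': "dist_Cauchy V' \<rho>' f'" "\<xi>' = ?r' `` {f'}"
      by (auto simp: dist_completion_def quotient_def)
    then have "range f' \<subseteq> V'" by (simp add: dist_Cauchy_def)
    then obtain f where f: "f \<in> Seq" "f' = \<sigma> \<circ> f" using lift by blast
    then have "?r `` {f} \<in> dist_completion V \<rho>"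
      using Cauchy_iff[of f] f' by (auto simp: dist_completion_def intro!: quotientI)
    then show "\<xi>' \<in> \<phi> ` dist_completion V \<rho>" using f f' \<phi>_class[of f] by blast
  qed
  have completion_Seq: "dist_completion V \<rho> \<subseteq> Pow Seq"
    using class_Seq by (auto simp: dist_completion_def quotient_def)
  have inj_\<phi>: "inj_on \<phi> (Pow Seq)"
    unfolding \<phi>_def by (rule inj_on_image_Pow[OF inj_comp])
  have points_Seq: "completion_point V \<rho> ` V \<subseteq> Pow Seq"
    using class_Seq by (auto simp: completion_point_def)
  have "\<phi> (completion_point V \<rho> x) = completion_point V' \<rho>' (\<sigma> x)" if "x \<in> V" for x
    using \<phi>_class[of "\<lambda>_. x"] that by (auto simp: completion_point_def Seq_def comp_def)
  then have \<phi>_points: "\<phi> ` completion_point V \<rho> ` V = completion_point V' \<rho>' ` V'"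
    by (simp add: image_image flip: \<sigma>V)
  have "\<phi> ` hyperbolic_boundary V E v0 a = hyperbolic_boundary V' E' v0' a"
    unfolding hyperbolic_boundary_def \<rho>_def[symmetric] \<rho>'_def[symmetric]
      \<phi>_completion[symmetric] \<phi>_points[symmetric]
    using completion_Seq points_Seq by (intro inj_on_image_set_diff[OF inj_\<phi>]) auto
  moreover have "inj_on \<phi> (hyperbolic_boundary V E v0 a)"
    using completion_Seq by (intro inj_on_subset[OF inj_\<phi>]) (auto simp: hyperbolic_boundary_def \<rho>_def)
  ultimately have bij: "bij_betw \<phi> (hyperbolic_boundary V E v0 a) (hyperbolic_boundary V' E' v0' a)"
    by (simp add: bij_betw_def)

  have dists: "boundary_dist E' v0' a (\<phi> \<xi>) (\<phi> \<eta>) \<le> c * boundary_dist E v0 a \<xi> \<eta> \<and>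
      boundary_dist E v0 a \<xi> \<eta> \<le> c * boundary_dist E' v0' a (\<phi> \<xi>) (\<phi> \<eta>)"
    if \<xi>\<eta>: "\<xi> \<in> dist_completion V \<rho>" "\<eta> \<in> dist_completion V \<rho>" for \<xi> \<eta>
  proof -
    define F F' where "F = (\<lambda>(f, g). real_of_ereal (limsup (\<lambda>k. ereal (\<rho> (f k) (g k)))))"
      and "F' = (\<lambda>(f, g). real_of_ereal (limsup (\<lambda>k. ereal (\<rho>' (\<sigma> (f k)) (\<sigma> (g k))))))"
    have "boundary_dist E v0 a \<xi> \<eta> = Inf (F ` (\<xi> \<times> \<eta>))"
      unfolding boundary_dist_def dist_extension_def \<rho>_def[symmetric] F_def
      by (rule arg_cong[of _ _ Inf]) auto
    moreover have "boundary_dist E' v0' a (\<phi> \<xi>) (\<phi> \<eta>) = Inf (F' ` (\<xi> \<times> \<eta>))"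
      unfolding boundary_dist_def dist_extension_def \<rho>'_def[symmetric] F'_def \<phi>_def
      by (rule arg_cong[of _ _ Inf]) (force simp: comp_def)
    moreover have "\<zeta> \<noteq> {}" if "\<zeta> \<in> dist_completion V \<rho>" for \<zeta>
    proof -
      from that obtain f where "dist_Cauchy V \<rho> f" "\<zeta> = ?r `` {f}"
        by (auto simp: dist_completion_def quotient_def)
      then have "f \<in> \<zeta>" by (simp add: Cauchy_equiv_def \<rho>_def visual_rho_def)
      then show ?thesis by auto
    qed
    then have "\<xi> \<times> \<eta> \<noteq> {}" using \<xi>\<eta> by auto
    moreover have "0 \<le> F i" "0 \<le> F' i" for i
      using real_limsup_nonneg bounds by (auto simp: F_def F'_def split: prod.split)
    moreover have "F' i \<le> c * F i" "F i \<le> c * F' i" if i: "i \<in> \<xi> \<times> \<eta>" for i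
    proof -
      obtain f g where fg: "i = (f, g)" "f \<in> Seq" "g \<in> Seq"
        using i \<xi>\<eta> completion_Seq by blast
      have V: "f k \<in> V" "g k \<in> V" for k using fg by (auto simp: Seq_def)
      then have V': "\<sigma> (f k) \<in> V'" "\<sigma> (g k) \<in> V'" for k using \<sigma>V by blast+
      show "F' i \<le> c * F i" "F i \<le> c * F' i"
        unfolding F_def F'_def fg prod.case
        using c V V' by (auto intro!: real_limsup_le bounds le ge \<rho>1 \<rho>1')
    qed
    ultimately show ?thesis
      using Inf_image_comparable[of "\<xi> \<times> \<eta>" c F F'] Inf_image_comparable[of "\<xi> \<times> \<eta>" c F' F] c
      by auto
  qed
  show ?thesis
    unfolding lipschitz_equivalent_def
  proof (intro exI conjI ballI)
    fix \<xi> \<eta> assume "\<xi> \<in> hyperbolic_boundary V E v0 a" "\<eta> \<in> hyperbolic_boundary V E v0 a"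
    then have "\<xi> \<in> dist_completion V \<rho>" "\<eta> \<in> dist_completion V \<rho>"
      by (auto simp: hyperbolic_boundary_def \<rho>_def)
    note d = dists[OF this]
    from d show "boundary_dist E' v0' a (\<phi> \<xi>) (\<phi> \<eta>) \<le> c * boundary_dist E v0 a \<xi> \<eta>" by simp
    from d c show "boundary_dist E v0 a \<xi> \<eta> / c \<le> boundary_dist E' v0' a (\<phi> \<xi>) (\<phi> \<eta>)"
      by (simp add: field_simps)
  qed (use bij c in auto)
qed


section \<open>Levels, parents and horizontal components\<close>

context augmented_tree
begin

lemma min_ratio_le: "i \<in> {1..N} \<Longrightarrow> min_ratio \<le> ratio i"
  unfolding min_ratio_def by (intro Min_le) auto

lemma min_ratio_pos: "min_ratio > 0" and min_ratio_less_1: "min_ratio < 1"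
proof -
  have "min_ratio \<in> ratio ` {1..N}"
    unfolding min_ratio_def using N_ge_1 by (intro Min_in) auto
  then show "min_ratio > 0" "min_ratio < 1" using ratio_pos ratio_less_1 by auto
qed

lemma word_ratio_Nil [simp]: "word_ratio [] = 1"
  by (simp add: word_ratio_def)

lemma word_ratio_append [simp]: "word_ratio (x @ y) = word_ratio x * word_ratio y"
  by (simp add: word_ratio_def)

lemma word_ratio_pos: "set x \<subseteq> {1..N} \<Longrightarrow> word_ratio x > 0"
  by (induction x) (auto simp: word_ratio_def ratio_pos)

lemma word_ratio_le_power:
  assumes "set x \<subseteq> {1..N}" and "\<And>i. i \<in> {1..N} \<Longrightarrow> ratio i \<le> q"
  shows "word_ratio x \<le> q ^ length x"
  using assms(1)
proof (induction x)
  case (Cons i x)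
  have "ratio i * word_ratio x \<le> q * q ^ length x"
    using Cons assms(2)[of i] ratio_pos[of i] word_ratio_pos[of x] by (intro mult_mono) auto
  then show ?case by (simp add: word_ratio_def)
qed simp

lemma prefix_word_ratio:
  assumes "prefix x y" and "set y \<subseteq> {1..N}"
  shows "word_ratio y \<le> word_ratio x"
proof -
  obtain z where z: "y = x @ z" using assms(1) by (auto simp: prefix_def)
  have "word_ratio z \<le> 1 ^ length z"
    using assms(2) z ratio_less_1 by (intro word_ratio_le_power) (auto intro: less_imp_le)
  then show ?thesis using word_ratio_pos[of x] assms(2) z by (auto intro: mult_left_le)
qed

lemma level_letters: "x \<in> level n \<Longrightarrow> set x \<subseteq> {1..N}"
  by (auto simp: level_def split: if_splits)

lemma level_0 [simp]: "level 0 = {[]}"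
  by (simp add: level_def)

lemma level_ratio_le: "x \<in> level n \<Longrightarrow> word_ratio x \<le> min_ratio ^ n"
  by (auto simp: level_def split: if_splits)

text \<open>
  Removing the last letter of a word of level \<open>n\<close> gives a ratio above \<open>min_ratio ^ n\<close>, and the
  letter itself contributes at least \<open>min_ratio\<close>.  So the ratios at level \<open>n\<close> lie between two
  consecutive powers, and the levels are disjoint.
\<close>

lemma level_ratio_greater:
  assumes "x \<in> level n"
  shows "min_ratio ^ Suc n < word_ratio x"
proof (cases "n = 0")
  case True
  then show ?thesis using assms min_ratio_less_1 by simp
next
  case False
  with assms have x: "x \<noteq> []" "set x \<subseteq> {1..N}" "min_ratio ^ n < word_ratio (butlast x)"
    by (auto simp: level_def)
  have "last x \<in> {1..N}" using x(1,2) last_in_set by blast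
  then have "min_ratio * min_ratio ^ n < ratio (last x) * word_ratio (butlast x)"
    using x min_ratio_le min_ratio_pos by (intro mult_le_less_imp_less) auto
  also have "\<dots> = word_ratio (butlast x @ [last x])"
    by (simp only: word_ratio_append) (simp add: word_ratio_def)
  finally show ?thesis using x(1) by simp
qed

lemma level_unique:
  assumes "x \<in> level n" and "x \<in> level k"
  shows "n = k"
proof -
  have "a \<le> b" if "x \<in> level a" "x \<in> level b" for a b
  proof -
    have "min_ratio ^ Suc b < min_ratio ^ a"
      using level_ratio_greater[OF that(2)] level_ratio_le[OF that(1)] by simp
    then have "a < Suc b"
      using min_ratio_pos min_ratio_less_1 by (metis not_less power_decreasing less_imp_le)
    then show ?thesis by simp
  qed
  then show ?thesis using assms by (intro antisym) auto
qed

lemma finite_level: "finite (level n)"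
proof -
  define q where "q = Max (ratio ` {1..N})"
  have q: "i \<in> {1..N} \<Longrightarrow> ratio i \<le> q" for i unfolding q_def by (intro Max_ge) auto
  have "q \<in> ratio ` {1..N}" unfolding q_def using N_ge_1 by (intro Max_in) auto
  then have "0 < q" "q < 1" using ratio_pos ratio_less_1 by auto
  then obtain l where l: "q ^ l < min_ratio ^ Suc n"
    using real_arch_pow_inv[of "min_ratio ^ Suc n" q] min_ratio_pos by auto
  have "length x \<le> l" if "x \<in> level n" for x
  proof (rule ccontr)
    assume "\<not> length x \<le> l"
    then have "q ^ length x \<le> q ^ l" using \<open>0 < q\<close> \<open>q < 1\<close> by (intro power_decreasing) auto
    then show False
      using word_ratio_le_power[OF level_letters[OF that] q] level_ratio_greater[OF that] l by simp
  qed
  then have "level n \<subseteq> {x. set x \<subseteq> {1..N} \<and> length x \<le> l}" using level_letters by auto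
  then show ?thesis by (rule finite_subset) (rule finite_lists_length_le, simp)
qed

lemma level_prefix_unique:
  assumes "x \<in> level n" "x' \<in> level n" "prefix x y" "prefix x' y"
  shows "x = x'"
proof -
  \<comment> \<open>A proper prefix is a prefix of the word without its last letter, whose ratio is too large.\<close>
  have "\<not> strict_prefix w w'" if "w \<in> level n" "w' \<in> level n" for w w'
  proof
    assume w: "strict_prefix w w'"
    then have "w' \<noteq> []" by auto
    then have "n \<noteq> 0" using that(2) by (cases n) auto
    then have greater: "min_ratio ^ n < word_ratio (butlast w')" using that(2) by (simp add: level_def)
    have "set (butlast w') \<subseteq> {1..N}" using level_letters[OF that(2)] by (auto dest: in_set_butlastD)
    moreover have "prefix w (butlast w')"
      using w \<open>w' \<noteq> []\<close> by (metis append_butlast_last_id prefix_order.dual_order.strict_iff_order prefix_snoc)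
    ultimately have "word_ratio (butlast w') \<le> word_ratio w" by (intro prefix_word_ratio)
    then show False using greater level_ratio_le[OF that(1)] by simp
  qed
  then show ?thesis
    using assms prefix_same_cases[OF assms(3,4)] by (auto simp: strict_prefix_def)
qed

lemma ex_parent:
  assumes "y \<in> level (Suc n)"
  shows "\<exists>x. x \<in> level n \<and> prefix x y"
proof (cases "n = 0")
  case False
  \<comment> \<open>The parent is the shortest prefix whose ratio is small enough.\<close>
  define k where "k = (LEAST k. word_ratio (take k y) \<le> min_ratio ^ n)"
  have "word_ratio (take (length y) y) \<le> min_ratio ^ n"
    using level_ratio_le[OF assms] min_ratio_pos min_ratio_less_1
    by (auto intro: order_trans mult_left_le_one_le)
  then have k: "word_ratio (take k y) \<le> min_ratio ^ n" and k_le: "k \<le> length y"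
    unfolding k_def by (rule LeastI, rule Least_le)
  have "min_ratio ^ n < 1" using False min_ratio_pos min_ratio_less_1 by (simp add: power_less_one_iff)
  then have "k \<noteq> 0" using k by (intro notI) simp
  then have "\<not> word_ratio (take (k - 1) y) \<le> min_ratio ^ n"
    unfolding k_def by (intro not_less_Least) simp
  moreover have "butlast (take k y) = take (k - 1) y" using k_le by (rule butlast_take)
  ultimately have "take k y \<in> level n"
    using k k_le \<open>k \<noteq> 0\<close> False level_letters[OF assms] set_take_subset[of k y]
    by (auto simp: level_def)
  then show ?thesis by (auto intro: take_is_prefix)
qed simp

definition parent :: "nat list \<Rightarrow> nat list" where
  "parent y = (THE x. (x, y) \<in> parent_rel)"

lemma parent_eq: "(x, y) \<in> parent_rel \<Longrightarrow> parent y = x"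
  unfolding parent_def parent_rel_def
  by (rule the_equality) (auto dest: level_unique level_prefix_unique)

lemma parent_in_rel:
  assumes "y \<in> level (Suc n)"
  shows "(parent y, y) \<in> parent_rel"
proof -
  obtain x where "(x, y) \<in> parent_rel"
    using ex_parent[OF assms] assms unfolding parent_rel_def by blast
  then show ?thesis using parent_eq by metis
qed

lemma parent_level: "y \<in> level (Suc n) \<Longrightarrow> parent y \<in> level n"
  using parent_in_rel[of y n] unfolding parent_rel_def by (auto dest: level_unique)

lemma parent_rel_level: "(x, y) \<in> parent_rel \<Longrightarrow> x \<in> level n \<longleftrightarrow> y \<in> level (Suc n)"
  unfolding parent_rel_def by (auto dest: level_unique)

lemma parent_rel_iff: "x \<in> level k \<Longrightarrow> (x, z) \<in> parent_rel \<longleftrightarrow> z \<in> level (Suc k) \<and> parent z = x"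
  using parent_eq parent_in_rel parent_rel_level by metis

lemma parent_rel_vertices: "(x, y) \<in> parent_rel \<Longrightarrow> x \<in> vertices \<and> y \<in> vertices"
  unfolding parent_rel_def vertices_def by blast

definition depth :: "nat list \<Rightarrow> nat" where
  "depth x = (THE n. x \<in> level n)"

lemma depth_eq: "x \<in> level n \<Longrightarrow> depth x = n"
  unfolding depth_def by (rule the_equality) (auto dest: level_unique)

lemma level_depth: "x \<in> vertices \<Longrightarrow> x \<in> level (depth x)"
  unfolding vertices_def using depth_eq by auto

lemma sym_horizontal: "sym horizontal_edges"
  unfolding horizontal_edges_def by (auto intro!: symI simp: setdist_sym)

lemma horizontal_level: "(x, y) \<in> horizontal_edges \<Longrightarrow> x \<in> level n \<longleftrightarrow> y \<in> level n"
  unfolding horizontal_edges_def by (auto dest: level_unique)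

lemma word_map_append: "word_map (x @ y) = word_map x \<circ> word_map y"
  by (induction x) (auto simp: word_map_def)

lemma word_map_K: "set x \<subseteq> {1..N} \<Longrightarrow> word_map x ` K \<subseteq> K"
proof (induction x)
  case (Cons i x)
  have "word_map (i # x) ` K = S i ` word_map x ` K" by (simp add: word_map_def image_comp)
  also have "\<dots> \<subseteq> S i ` K" using Cons by (intro image_mono) auto
  also have "\<dots> \<subseteq> (\<Union>i\<in>{1..N}. S i ` K)" using Cons.prems by auto
  also have "\<dots> = K" by (rule K_invariant[symmetric])
  finally show ?case .
qed (simp add: word_map_def)

lemma word_map_prefix:
  assumes "prefix x y" and "set y \<subseteq> {1..N}"
  shows "word_map y ` K \<subseteq> word_map x ` K"
proof -
  obtain z where z: "y = x @ z" using assms(1) by (auto simp: prefix_def)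
  then have "word_map y ` K = word_map x ` word_map z ` K" by (simp add: word_map_append image_comp)
  then show ?thesis using word_map_K[of z] assms(2) z by (auto intro!: image_mono)
qed

text \<open>
  The sets \<open>word_map x ` K\<close> grow towards the root, and so does the admissible distance.  Through
  this lemma the geometry of the iterated function system enters the combinatorics of components.
\<close>

lemma horizontal_parents:
  assumes xy: "(x, y) \<in> horizontal_edges" and x: "x \<in> level (Suc n)"
  shows "parent x = parent y \<or> (parent x, parent y) \<in> horizontal_edges"
proof -
  have y: "y \<in> level (Suc n)" using horizontal_level[OF xy] x by simp
  have sub: "word_map w ` K \<subseteq> word_map (parent w) ` K" if "w \<in> level (Suc n)" for w
    using parent_in_rel[OF that] level_letters[OF that] 
    by (intro word_map_prefix) (auto simp: parent_rel_def)
  have "setdist (word_map (parent x) ` K) (word_map (parent y) ` K)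
      \<le> setdist (word_map x ` K) (word_map (parent y) ` K)"
    using K_nonempty by (intro setdist_subset_left sub[OF x]) simp
  also have "\<dots> \<le> setdist (word_map x ` K) (word_map y ` K)"
    using K_nonempty by (intro setdist_subset_right sub[OF y]) simp
  also have "\<dots> \<le> kappa * min_ratio ^ Suc n"
    using xy x unfolding horizontal_edges_def by (auto dest: level_unique)
  also have "\<dots> \<le> kappa * min_ratio ^ n"
    using kappa_pos min_ratio_pos min_ratio_less_1 by (intro mult_left_mono power_decreasing) auto
  finally show ?thesis
    using parent_level[OF x] parent_level[OF y] unfolding horizontal_edges_def by auto
qed

definition component_of :: "nat list \<Rightarrow> nat list set" where
  "component_of x = horizontal_edges\<^sup>* `` {x}"

lemma component_of_self [simp]: "x \<in> component_of x"
  by (simp add: component_of_def)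

lemma component_of_eq_iff: "component_of x = component_of y \<longleftrightarrow> y \<in> component_of x"
proof
  assume "y \<in> component_of x"
  then have "(x, y) \<in> horizontal_edges\<^sup>*" "(y, x) \<in> horizontal_edges\<^sup>*"
    using symD[OF sym_rtrancl[OF sym_horizontal]] by (auto simp: component_of_def)
  then show "component_of x = component_of y"
    unfolding component_of_def by (auto intro: rtrancl_trans)
qed (metis component_of_self)

lemma component_of_edge: "(x, y) \<in> horizontal_edges \<Longrightarrow> component_of x = component_of y"
  unfolding component_of_eq_iff by (auto simp: component_of_def)

lemma component_of_level:
  assumes "x \<in> level n"
  shows "component_of x \<subseteq> level n"
proof
  fix y assume "y \<in> component_of x"
  then have "(x, y) \<in> horizontal_edges\<^sup>*" by (simp add: component_of_def)
  then show "y \<in> level n" by induction (use assms horizontal_level in auto)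
qed

text \<open>
  By this lemma the components themselves form a tree, and the children of a component are a union
  of components.
\<close>

lemma component_of_parent:
  assumes "x \<in> level (Suc n)" and "component_of x = component_of y"
  shows "component_of (parent x) = component_of (parent y)"
proof -
  have "(x, y) \<in> horizontal_edges\<^sup>*" using assms(2) unfolding component_of_eq_iff by (simp add: component_of_def)
  then have "y \<in> level (Suc n) \<and> component_of (parent x) = component_of (parent y)"
  proof induction
    case (step y z)
    then show ?case
      using horizontal_level[OF step(2)] horizontal_parents[OF step(2)] component_of_edge by metis
  qed (use assms(1) in simp)
  then show ?thesis ..
qed

lemma horizontally_connected_component_of: "horizontally_connected (component_of x)"
proof -
  let ?H = "horizontal_edges \<inter> component_of x \<times> component_of x"
  have path: "(x, y) \<in> ?H\<^sup>*"
    if "(x, y) \<in> horizontal_edges\<^sup>*" for y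
    using that
  proof induction
    case (step y z)
    then have "(y, z) \<in> horizontal_edges \<inter> component_of x \<times> component_of x"
      by (auto simp: component_of_def)
    then show ?case using step by (auto intro: rtrancl_into_rtrancl)
  qed simp
  have "sym ?H" using sym_horizontal by (auto simp: sym_def)
  then have sym: "sym (?H\<^sup>*)" by (rule sym_rtrancl)
  show ?thesis
    unfolding horizontally_connected_def
  proof (intro ballI)
    fix y z assume "y \<in> component_of x" "z \<in> component_of x"
    then have "(x, y) \<in> ?H\<^sup>*" "(x, z) \<in> ?H\<^sup>*" using path by (auto simp: component_of_def)
    then show "(y, z) \<in> ?H\<^sup>*" using symD[OF sym] by (blast intro: rtrancl_trans)
  qed
qed

lemma horizontally_connected_subset:
  assumes "horizontally_connected T" and "x \<in> T"
  shows "T \<subseteq> component_of x"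
proof
  fix y assume "y \<in> T"
  then have "(x, y) \<in> (horizontal_edges \<inter> T \<times> T)\<^sup>*"
    using assms by (auto simp: horizontally_connected_def)
  then show "y \<in> component_of x"
    unfolding component_of_def using rtrancl_mono[of "horizontal_edges \<inter> T \<times> T" horizontal_edges] by auto
qed

lemma horizontal_components_eq: "horizontal_components = component_of ` vertices"
proof (intro equalityI subsetI)
  fix T assume "T \<in> horizontal_components"
  then obtain n where T: "T \<noteq> {}" "T \<subseteq> level n" "horizontally_connected T"
    and max: "\<And>T'. T \<subseteq> T' \<Longrightarrow> T' \<subseteq> level n \<Longrightarrow> horizontally_connected T' \<Longrightarrow> T' = T"
    unfolding horizontal_components_def mem_Collect_eq by metis
  then obtain x where "x \<in> T" by blast
  have "component_of x = T"
    using T \<open>x \<in> T\<close> by (intro max horizontally_connected_subset component_of_level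
        horizontally_connected_component_of) auto
  then show "T \<in> component_of ` vertices" using T \<open>x \<in> T\<close> unfolding vertices_def by blast
next
  fix T assume "T \<in> component_of ` vertices"
  then obtain n x where x: "x \<in> level n" "T = component_of x" by (auto simp: vertices_def)
  moreover have "T' = T" if "T \<subseteq> T'" "horizontally_connected T'" for T'
    using that x horizontally_connected_subset[of T' x] by (metis component_of_self subset_antisym subsetD)
  ultimately show "T \<in> horizontal_components"
    unfolding horizontal_components_def mem_Collect_eq
    using component_of_level[OF x(1)] horizontally_connected_component_of[of x] component_of_self[of x]
    by (intro exI[of _ n]) blast
qed

lemma component_eq_component_of: "T \<in> horizontal_components \<Longrightarrow> x \<in> T \<Longrightarrow> T = component_of x"
  unfolding horizontal_components_eq by (metis component_of_eq_iff imageE)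

lemma component_level:
  assumes "T \<in> horizontal_components"
  shows "\<exists>n. T \<subseteq> level n"
  using assms unfolding horizontal_components_def by auto

lemma component_finite: "T \<in> horizontal_components \<Longrightarrow> finite T"
  using component_level finite_level finite_subset by blast

lemma component_vertices: "T \<in> horizontal_components \<Longrightarrow> T \<subseteq> vertices"
  using component_level unfolding vertices_def by blast

lemma component_of_in: "x \<in> vertices \<Longrightarrow> component_of x \<in> horizontal_components"
  by (simp add: horizontal_components_eq)

lemma children_iff:
  assumes "T \<in> horizontal_components" and "T \<subseteq> level n"
  shows "z \<in> parent_rel `` T \<longleftrightarrow> z \<in> level (Suc n) \<and> component_of (parent z) = T"
proof
  assume "z \<in> parent_rel `` T"
  then obtain x where x: "x \<in> T" "(x, z) \<in> parent_rel" by auto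
  then show "z \<in> level (Suc n) \<and> component_of (parent z) = T"
    using parent_eq[OF x(2)] parent_rel_level[OF x(2), of n] assms(2)
      component_eq_component_of[OF assms(1) x(1)] by (metis subsetD x(1))
next
  assume z: "z \<in> level (Suc n) \<and> component_of (parent z) = T"
  then have "parent z \<in> T" using component_of_self by blast
  then show "z \<in> parent_rel `` T" using z parent_in_rel by blast
qed

lemma finite_children: "T \<in> horizontal_components \<Longrightarrow> finite (parent_rel `` T)"
  using component_level children_iff finite_level by (metis finite_subset subsetI)

lemma component_of_children:
  assumes "T \<in> horizontal_components" and "z \<in> parent_rel `` T"
  shows "component_of z \<subseteq> parent_rel `` T"
proof
  fix y assume y: "y \<in> component_of z"
  obtain n where n: "T \<subseteq> level n" using component_level assms(1) by blast
  note iff = children_iff[OF assms(1) n]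
  have z: "z \<in> level (Suc n)" "component_of (parent z) = T" using assms(2) iff by auto
  show "y \<in> parent_rel `` T"
    using iff y z component_of_level[OF z(1)] component_of_parent[OF z(1), of y]
      component_of_eq_iff[of z y] by auto
qed


end

section \<open>Isomorphisms preserve the incidence numbers\<close>

text \<open>
  Both equivalences of the augmented tree are instances of isomorphism with respect to a family of
  relations: \<open>parent_rel\<close> alone for vertices, \<open>parent_rel\<close> and \<open>horizontal_edges\<close> for components.
\<close>

definition isomorphism :: "('v \<times> 'v) set set \<Rightarrow> 'v set \<Rightarrow> 'v set \<Rightarrow> ('v \<Rightarrow> 'v) \<Rightarrow> bool" where
  "isomorphism \<R> A B \<sigma> \<longleftrightarrow> bij_betw \<sigma> A B \<and>
     (\<forall>R\<in>\<R>. \<forall>x\<in>A. \<forall>y\<in>A. (\<sigma> x, \<sigma> y) \<in> R \<longleftrightarrow> (x, y) \<in> R)"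

lemma ex_isomorphism_refl: "\<exists>\<sigma>. isomorphism \<R> A A \<sigma>"
  by (rule exI[of _ id]) (simp add: isomorphism_def)

lemma isomorphism_comp:
  assumes "isomorphism \<R> A B \<sigma>" and "isomorphism \<R> B C \<tau>"
  shows "isomorphism \<R> A C (\<tau> \<circ> \<sigma>)"
  using assms bij_betw_trans bij_betwE unfolding isomorphism_def comp_apply by metis

lemma isomorphism_inv:
  assumes "isomorphism \<R> A B \<sigma>"
  shows "isomorphism \<R> B A (inv_into A \<sigma>)"
proof -
  have "bij_betw \<sigma> A B" using assms by (simp add: isomorphism_def)
  note inv = bij_betw_inv_into[OF this] bij_betwE[OF bij_betw_inv_into[OF this]]
    bij_betw_inv_into_right[OF this]
  show ?thesis using assms inv unfolding isomorphism_def by metis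
qed

lemma isomorphism_image:
  assumes iso: "isomorphism \<R> A B \<sigma>" and R: "R \<in> \<R>" and A: "R `` A \<subseteq> A" and B: "R `` B \<subseteq> B"
    and U: "U \<subseteq> A"
  shows "\<sigma> ` (R `` U) = R `` (\<sigma> ` U)"
proof -
  have bij: "bij_betw \<sigma> A B" and rel: "\<And>x y. x \<in> A \<Longrightarrow> y \<in> A \<Longrightarrow> (\<sigma> x, \<sigma> y) \<in> R \<longleftrightarrow> (x, y) \<in> R"
    using iso R by (auto simp: isomorphism_def)
  show ?thesis
  proof (intro equalityI subsetI)
    fix y' assume "y' \<in> \<sigma> ` (R `` U)"
    then obtain x y where "x \<in> U" "(x, y) \<in> R" "y' = \<sigma> y" by auto
    then show "y' \<in> R `` (\<sigma> ` U)" using rel[of x y] U A by blast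
  next
    fix y' assume "y' \<in> R `` (\<sigma> ` U)"
    then obtain x where x: "x \<in> U" "(\<sigma> x, y') \<in> R" by auto
    then have "y' \<in> B" using B U bij_betwE[OF bij] by blast
    then obtain y where "y \<in> A" "y' = \<sigma> y" using bij_betw_imp_surj_on[OF bij] by blast
    then show "y' \<in> \<sigma> ` (R `` U)" using x rel[of x y] U by blast
  qed
qed

text \<open>
  With \<open>parent_rel\<close> as \<open>R\<close> this says that isomorphisms preserve sets of descendants, with
  \<open>horizontal_edges\<close> as \<open>R\<close> that they preserve horizontal components.
\<close>

lemma isomorphism_rtrancl:
  assumes iso: "isomorphism \<R> A B \<sigma>" and R: "R \<in> \<R>" and A: "R `` A \<subseteq> A" and B: "R `` B \<subseteq> B"
    and U: "U \<subseteq> A"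
  shows "\<sigma> ` (R\<^sup>* `` U) = R\<^sup>* `` (\<sigma> ` U)"
proof -
  have closed: "R\<^sup>* `` U \<subseteq> A" using Image_closed_trancl[OF A] U by blast
  show ?thesis
  proof (intro equalityI subsetI)
    fix y' assume "y' \<in> \<sigma> ` (R\<^sup>* `` U)"
    then obtain x y where x: "x \<in> U" and xy: "(x, y) \<in> R\<^sup>*" and y': "y' = \<sigma> y" by auto
    from xy have "(\<sigma> x, \<sigma> y) \<in> R\<^sup>*"
    proof induction
      case (step y z)
      have "{y, z} \<subseteq> A" using closed x step by (auto intro: rtrancl_into_rtrancl)
      then have "(\<sigma> y, \<sigma> z) \<in> R" using iso R step(2) by (auto simp: isomorphism_def)
      then show ?case using step by (auto intro: rtrancl_into_rtrancl)
    qed simp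
    then show "y' \<in> R\<^sup>* `` (\<sigma> ` U)" using x y' by blast
  next
    fix y' assume "y' \<in> R\<^sup>* `` (\<sigma> ` U)"
    then obtain x where x: "x \<in> U" and "(\<sigma> x, y') \<in> R\<^sup>*" by auto
    from this(2) show "y' \<in> \<sigma> ` (R\<^sup>* `` U)"
    proof induction
      case (step y' z')
      then obtain y where y: "y \<in> R\<^sup>* `` U" "y' = \<sigma> y" by auto
      then have "z' \<in> R `` (\<sigma> ` {y})" using step by auto
      then have "z' \<in> \<sigma> ` (R `` {y})"
        using isomorphism_image[OF iso R A B, of "{y}"] y closed by auto
      then show ?case using y by (auto intro: rtrancl_into_rtrancl)
    qed (use x in auto)
  qed
qed

lemma isomorphism_roots:
  assumes "isomorphism \<R> A B \<sigma>" and "R \<in> \<R>"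
  shows "\<sigma> ` {x \<in> A. \<forall>z\<in>A. (z, x) \<notin> R} = {x \<in> B. \<forall>z\<in>B. (z, x) \<notin> R}"
proof -
  have "B = \<sigma> ` A" using assms by (simp add: isomorphism_def bij_betw_def)
  moreover have "(\<sigma> x, \<sigma> y) \<in> R \<longleftrightarrow> (x, y) \<in> R" if "x \<in> A" "y \<in> A" for x y
    using assms that by (simp add: isomorphism_def)
  ultimately show ?thesis by auto
qed

lemma isomorphism_subset:
  assumes "isomorphism \<R> A B \<sigma>" and "U \<subseteq> A" and "\<Q> \<subseteq> \<R>"
  shows "isomorphism \<Q> U (\<sigma> ` U) \<sigma>"
  using assms unfolding isomorphism_def by (blast intro: bij_betw_subset)

context augmented_tree
begin

lemma vertex_equiv_iff:
  "(x, y) \<in> vertex_equiv \<longleftrightarrow> x \<in> vertices \<and> y \<in> vertices \<and>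
     (\<exists>\<sigma>. isomorphism {parent_rel} (descendants {x}) (descendants {y}) \<sigma>)"
  by (simp add: vertex_equiv_def isomorphism_def)

lemma component_equiv_iff:
  "(T, T') \<in> component_equiv \<longleftrightarrow> T \<in> horizontal_components \<and> T' \<in> horizontal_components \<and>
     (\<exists>\<sigma>. isomorphism {parent_rel, horizontal_edges} (descendants T) (descendants T') \<sigma>)"
  by (simp add: component_equiv_def isomorphism_def ball_conj_distrib)

lemma equiv_vertex_equiv: "equiv vertices vertex_equiv"
proof (rule equivI)
  show "vertex_equiv \<subseteq> vertices \<times> vertices" by (auto simp: vertex_equiv_iff)
  show "refl_on vertices vertex_equiv"
    by (auto intro!: refl_onI simp: vertex_equiv_iff ex_isomorphism_refl)
  show "sym vertex_equiv"
    unfolding sym_def vertex_equiv_iff by (blast intro: isomorphism_inv)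
  show "trans vertex_equiv"
    unfolding trans_def vertex_equiv_iff by (blast intro: isomorphism_comp)
qed

lemma equiv_component_equiv: "equiv horizontal_components component_equiv"
proof (rule equivI)
  show "component_equiv \<subseteq> horizontal_components \<times> horizontal_components"
    by (auto simp: component_equiv_iff)
  show "refl_on horizontal_components component_equiv"
    by (auto intro!: refl_onI simp: component_equiv_iff ex_isomorphism_refl)
  show "sym component_equiv"
    unfolding sym_def component_equiv_iff by (blast intro: isomorphism_inv)
  show "trans component_equiv"
    unfolding trans_def component_equiv_iff by (blast intro: isomorphism_comp)
qed

lemma descendants_children: "parent_rel `` descendants T \<subseteq> descendants T"
  unfolding descendants_def by (auto intro: rtrancl_into_rtrancl)

lemma descendants_self: "T \<subseteq> descendants T"
  unfolding descendants_def by auto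

lemma descendants_roots:
  assumes "T \<subseteq> level n"
  shows "{x \<in> descendants T. \<forall>z\<in>descendants T. (z, x) \<notin> parent_rel} = T"
proof (intro equalityI subsetI)
  fix x assume x: "x \<in> {x \<in> descendants T. \<forall>z\<in>descendants T. (z, x) \<notin> parent_rel}"
  then obtain t where "t \<in> T" "(t, x) \<in> parent_rel\<^sup>*" by (auto simp: descendants_def)
  from this(2) show "x \<in> T"
  proof (cases rule: rtranclE)
    case (step y)
    then show ?thesis using x \<open>t \<in> T\<close> by (auto simp: descendants_def)
  qed (use \<open>t \<in> T\<close> in simp)
next
  fix x assume x: "x \<in> T"
  have deep: "\<exists>k\<ge>n. z \<in> level k" if "(t, z) \<in> parent_rel\<^sup>*" "t \<in> T" for t z
    using that
  proof induction
    case (step y z)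
    then show ?case using parent_rel_level[OF step(2)] le_SucI by metis
  qed (use assms in auto)
  have "(z, x) \<notin> parent_rel" if z: "z \<in> descendants T" for z
  proof
    assume zx: "(z, x) \<in> parent_rel"
    from z obtain k where "k \<ge> n" "z \<in> level k" using deep by (auto simp: descendants_def)
    moreover from this have "x \<in> level (Suc k)" using parent_rel_level[OF zx] by blast
    moreover have "x \<in> level n" using x assms by auto
    ultimately show False using level_unique[of x n "Suc k"] by simp
  qed
  then show "x \<in> {x \<in> descendants T. \<forall>z\<in>descendants T. (z, x) \<notin> parent_rel}"
    using x descendants_self by auto
qed

text \<open>
  An isomorphism of the descendants maps the initial level to the initial level, because its
  elements are exactly those whose parent is missing.
\<close>

lemma descendants_isomorphism_image:
  assumes "isomorphism \<R> (descendants T) (descendants T') \<sigma>" "parent_rel \<in> \<R>"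
    and "T \<subseteq> level n" "T' \<subseteq> level n'"
  shows "\<sigma> ` T = T'"
  using isomorphism_roots[OF assms(1,2)] descendants_roots assms(3,4) by simp

lemma descendants_isomorphism_subset:
  assumes iso: "isomorphism \<R> (descendants T) (descendants T') \<sigma>" "parent_rel \<in> \<R>"
    and U: "U \<subseteq> descendants T" and \<Q>: "\<Q> \<subseteq> \<R>"
  shows "isomorphism \<Q> (descendants U) (descendants (\<sigma> ` U)) \<sigma>"
proof -
  have "\<sigma> ` descendants U = descendants (\<sigma> ` U)"
    unfolding descendants_def[of U] descendants_def[of "\<sigma> ` U"]
    by (rule isomorphism_rtrancl[OF iso descendants_children descendants_children U])
  moreover have "descendants U \<subseteq> descendants T"
    using Image_closed_trancl[OF descendants_children] U unfolding descendants_def[of U] by blast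
  ultimately show ?thesis using isomorphism_subset[OF iso(1) _ \<Q>] by metis
qed

lemma descendants_isomorphism_children:
  assumes "isomorphism \<R> (descendants T) (descendants T') \<sigma>" "parent_rel \<in> \<R>"
    and "U \<subseteq> descendants T"
  shows "\<sigma> ` (parent_rel `` U) = parent_rel `` (\<sigma> ` U)"
  by (rule isomorphism_image[OF assms(1,2) descendants_children descendants_children assms(3)])

lemma descendants_vertices:
  assumes "T \<subseteq> vertices"
  shows "descendants T \<subseteq> vertices"
proof -
  have "parent_rel `` vertices \<subseteq> vertices" using parent_rel_vertices by blast
  then have "parent_rel\<^sup>* `` vertices = vertices" by (rule Image_closed_trancl)
  then show ?thesis using assms unfolding descendants_def by blast
qed

lemma descendants_isomorphism_vertex_equiv:
  assumes "isomorphism \<R> (descendants T) (descendants T') \<sigma>" "parent_rel \<in> \<R>"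
    and "T \<subseteq> vertices" "T' \<subseteq> vertices" "x \<in> descendants T"
  shows "(x, \<sigma> x) \<in> vertex_equiv"
proof -
  have "\<sigma> x \<in> descendants T'" using assms(1,5) by (auto simp: isomorphism_def dest: bij_betwE)
  then show ?thesis
    using descendants_isomorphism_subset[OF assms(1,2), of "{x}" "{parent_rel}"] assms
      descendants_vertices[OF assms(3)] descendants_vertices[OF assms(4)]
    by (auto simp: vertex_equiv_iff)
qed

text \<open>
  An isomorphism embeds the children of one vertex into those of the other and preserves their
  classes; as the equivalence is symmetric, the inequality of cardinalities suffices.
\<close>

lemma vertex_equiv_children_card:
  assumes "(x, y) \<in> vertex_equiv" and sat: "vertex_equiv `` Q \<subseteq> Q"
  shows "card {z \<in> Q. (x, z) \<in> parent_rel} = card {z \<in> Q. (y, z) \<in> parent_rel}"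
proof -
  have le: "card {z \<in> Q. (x, z) \<in> parent_rel} \<le> card {z \<in> Q. (y, z) \<in> parent_rel}"
    if xy: "(x, y) \<in> vertex_equiv" for x y
  proof -
    obtain \<sigma> where \<sigma>: "isomorphism {parent_rel} (descendants {x}) (descendants {y}) \<sigma>"
      and V: "x \<in> vertices" "y \<in> vertices"
      using xy by (auto simp: vertex_equiv_iff)
    have "\<sigma> ` {x} = {y}"
      using V level_depth by (intro descendants_isomorphism_image[OF \<sigma>]) auto
    then have children: "\<sigma> ` (parent_rel `` {x}) = parent_rel `` {y}"
      using descendants_isomorphism_children[OF \<sigma> _ descendants_self] by simp
    have sub: "parent_rel `` {x} \<subseteq> descendants {x}"
      using descendants_children[of "{x}"] descendants_self[of "{x}"] by blast
    have "(z, \<sigma> z) \<in> vertex_equiv" if "(x, z) \<in> parent_rel" for z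
      using V that sub by (intro descendants_isomorphism_vertex_equiv[OF \<sigma>]) auto
    then have image: "\<sigma> ` {z \<in> Q. (x, z) \<in> parent_rel} \<subseteq> {z \<in> Q. (y, z) \<in> parent_rel}"
      using children sat by blast
    have "inj_on \<sigma> {z \<in> Q. (x, z) \<in> parent_rel}"
      using \<sigma> sub by (auto simp: isomorphism_def bij_betw_def intro: inj_on_subset)
    moreover have "finite {z \<in> Q. (y, z) \<in> parent_rel}"
      using parent_rel_level[of y _ "depth y"] level_depth[OF V(2)] 
      by (intro finite_subset[OF _ finite_level[of "Suc (depth y)"]]) auto
    ultimately show ?thesis using image card_inj_on_le by blast
  qed
  have "(y, x) \<in> vertex_equiv" using assms(1) equiv_vertex_equiv by (auto simp: equiv_def dest: symD)
  then show ?thesis using le assms(1) by (intro antisym) auto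
qed

lemma component_equiv_vertex_card:
  assumes "(T, T') \<in> component_equiv" and sat: "vertex_equiv `` Q \<subseteq> Q"
  shows "card {x \<in> T. x \<in> Q} = card {x \<in> T'. x \<in> Q}"
proof -
  have le: "card {x \<in> T. x \<in> Q} \<le> card {x \<in> T'. x \<in> Q}" if TT': "(T, T') \<in> component_equiv" for T T'
  proof -
    obtain \<sigma> where \<sigma>: "isomorphism {parent_rel, horizontal_edges} (descendants T) (descendants T') \<sigma>"
      and hc: "T \<in> horizontal_components" "T' \<in> horizontal_components"
      using TT' by (auto simp: component_equiv_iff)
    obtain k k' where "T \<subseteq> level k" "T' \<subseteq> level k'" using component_level hc by metis
    then have image: "\<sigma> ` T = T'" by (intro descendants_isomorphism_image[OF \<sigma>]) auto
    have "(x, \<sigma> x) \<in> vertex_equiv" if "x \<in> T" for x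
      using that component_vertices hc descendants_self
      by (intro descendants_isomorphism_vertex_equiv[OF \<sigma>]) auto
    then have "\<sigma> ` {x \<in> T. x \<in> Q} \<subseteq> {x \<in> T'. x \<in> Q}" using sat image by blast
    moreover have "inj_on \<sigma> {x \<in> T. x \<in> Q}"
      using \<sigma> descendants_self[of T] by (auto simp: isomorphism_def bij_betw_def intro: inj_on_subset)
    moreover have "finite {x \<in> T'. x \<in> Q}" using component_finite[OF hc(2)] by simp
    ultimately show ?thesis using card_inj_on_le by blast
  qed
  have "(T', T) \<in> component_equiv"
    using assms(1) equiv_component_equiv by (auto simp: equiv_def dest: symD)
  then show ?thesis using le assms(1) by (intro antisym) auto
qed

text \<open>
  Horizontal neighbours of descendants of \<open>T\<close> have parents that are equal or neighbours themselves;
  going up to the level of \<open>T\<close>, one arrives in the component \<open>T\<close>.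
\<close>

lemma descendants_horizontal:
  assumes "T \<in> horizontal_components"
  shows "horizontal_edges `` descendants T \<subseteq> descendants T"
proof -
  obtain n where n: "T \<subseteq> level n" using component_level assms by blast
  have "\<forall>v. (w, v) \<in> horizontal_edges \<longrightarrow> v \<in> descendants T"
    if "(t, w) \<in> parent_rel\<^sup>*" "t \<in> T" for t w
    using that
  proof induction
    case base
    then have "T = component_of t" using component_eq_component_of assms by blast
    then show ?case using descendants_self[of T] by (auto simp: component_of_def)
  next
    case (step w0 w)
    show ?case
    proof (intro allI impI)
      fix v assume wv: "(w, v) \<in> horizontal_edges"
      have w0: "w0 \<in> descendants T" using step by (auto simp: descendants_def)
      obtain k where w: "w \<in> level (Suc k)" using step(2) by (auto simp: parent_rel_def)
      then have v: "v \<in> level (Suc k)" using horizontal_level[OF wv] by simp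
      have "parent v \<in> descendants T"
        using horizontal_parents[OF wv w] parent_eq[OF step(2)] step w0 by auto
      then show "v \<in> descendants T" using parent_in_rel[OF v] descendants_children by blast
    qed
  qed
  then show ?thesis by (auto simp: descendants_def)
qed

text \<open>
  The descendants of a component are closed under horizontal edges, hence an isomorphism between
  them maps horizontal components to horizontal components.
\<close>

lemma component_equiv_children_card:
  assumes "(T, T') \<in> component_equiv" and sat: "component_equiv `` Q \<subseteq> Q"
    and Q: "Q \<subseteq> horizontal_components"
  shows "card {Z \<in> Q. Z \<subseteq> parent_rel `` T} = card {Z \<in> Q. Z \<subseteq> parent_rel `` T'}"
proof -
  have le: "card {Z \<in> Q. Z \<subseteq> parent_rel `` T} \<le> card {Z \<in> Q. Z \<subseteq> parent_rel `` T'}"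
    if TT': "(T, T') \<in> component_equiv" for T T'
  proof -
    obtain \<sigma> where \<sigma>: "isomorphism {parent_rel, horizontal_edges} (descendants T) (descendants T') \<sigma>"
      and hc: "T \<in> horizontal_components" "T' \<in> horizontal_components"
      using TT' by (auto simp: component_equiv_iff)
    obtain k k' where "T \<subseteq> level k" "T' \<subseteq> level k'" using component_level hc by metis
    then have "\<sigma> ` T = T'" by (intro descendants_isomorphism_image[OF \<sigma>]) auto
    then have children: "\<sigma> ` (parent_rel `` T) = parent_rel `` T'"
      using descendants_isomorphism_children[OF \<sigma> _ descendants_self] by simp
    have sub: "parent_rel `` T \<subseteq> descendants T"
      using descendants_children[of T] descendants_self[of T] by blast
    have "\<sigma> ` Z \<in> Q \<and> \<sigma> ` Z \<subseteq> parent_rel `` T'" if Z: "Z \<in> Q" "Z \<subseteq> parent_rel `` T" for Z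
    proof
      have ZD: "Z \<subseteq> descendants T" using Z sub by blast
      obtain z where z: "z \<in> Z" "Z = component_of z"
        using Z(1) Q by (auto simp: horizontal_components_eq)
      have "\<sigma> ` Z = component_of (\<sigma> z)"
        using isomorphism_rtrancl[OF \<sigma> _ descendants_horizontal[OF hc(1)] descendants_horizontal[OF hc(2)],
            of "{z}"] z ZD by (auto simp: component_of_def)
      moreover have "\<sigma> z \<in> vertices"
        using descendants_isomorphism_vertex_equiv[OF \<sigma> _ component_vertices component_vertices, of z]
          hc z(1) ZD by (auto simp: vertex_equiv_iff)
      ultimately have "\<sigma> ` Z \<in> horizontal_components" by (simp add: component_of_in)
      then have "(Z, \<sigma> ` Z) \<in> component_equiv"
        using descendants_isomorphism_subset[OF \<sigma> _ ZD subset_refl] Z(1) Q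
        by (auto simp: component_equiv_iff)
      then show "\<sigma> ` Z \<in> Q" using sat Z(1) by blast
      show "\<sigma> ` Z \<subseteq> parent_rel `` T'" using children Z(2) by blast
    qed
    then have "(`) \<sigma> ` {Z \<in> Q. Z \<subseteq> parent_rel `` T} \<subseteq> {Z \<in> Q. Z \<subseteq> parent_rel `` T'}" by blast
    moreover have "inj_on ((`) \<sigma>) {Z \<in> Q. Z \<subseteq> parent_rel `` T}"
      using \<sigma> sub by (intro inj_on_subset[OF inj_on_image_Pow[of \<sigma> "descendants T"]])
        (auto simp: isomorphism_def bij_betw_def)
    moreover have "finite {Z \<in> Q. Z \<subseteq> parent_rel `` T'}"
      by (rule rev_finite_subset[OF finite_Pow_iff[THEN iffD2, OF finite_children[OF hc(2)]]]) auto
    ultimately show ?thesis using card_inj_on_le by blast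
  qed
  have "(T', T) \<in> component_equiv"
    using assms(1) equiv_component_equiv by (auto simp: equiv_def dest: symD)
  then show ?thesis using le assms(1) by (intro antisym) auto
qed

end

section \<open>Rearranged parents\<close>

locale rearrangeable_augmented_tree = augmented_tree +
  fixes m n :: nat
    and Tc :: "nat \<Rightarrow> nat list set set"
    and tc :: "nat \<Rightarrow> nat list set"
  assumes bij_Tc: "bij_betw Tc {1..m} component_classes"
    and bij_tc: "bij_betw tc {1..n} vertex_classes"
    and rearrangeable:
      "rearrangeable m n (vertex_incidence tc) (class_representation Tc tc) (component_incidence Tc)"
begin

lemma Tc_quotient: "j \<in> {1..m} \<Longrightarrow> Tc j \<in> horizontal_components // component_equiv"
  using bij_betwE[OF bij_Tc] by (simp add: component_classes_def)

lemma tc_quotient: "l \<in> {1..n} \<Longrightarrow> tc l \<in> vertices // vertex_equiv"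
  using bij_betwE[OF bij_tc] by (simp add: vertex_classes_def)

lemma Tc_components: "j \<in> {1..m} \<Longrightarrow> Tc j \<subseteq> horizontal_components"
  using in_quotient_imp_subset[OF equiv_component_equiv Tc_quotient] .

lemma Tc_saturated: "j \<in> {1..m} \<Longrightarrow> component_equiv `` Tc j \<subseteq> Tc j"
  using in_quotient_imp_closed[OF equiv_component_equiv Tc_quotient] by blast

lemma tc_saturated: "l \<in> {1..n} \<Longrightarrow> vertex_equiv `` tc l \<subseteq> tc l"
  using in_quotient_imp_closed[OF equiv_vertex_equiv tc_quotient] by blast

text \<open>
  The incidence numbers are defined by means of a representative of each class.  The next lemmas
  transfer them to all elements of the class.
\<close>

lemma Tc_some: "j \<in> {1..m} \<Longrightarrow> T \<in> Tc j \<Longrightarrow> (SOME T. T \<in> Tc j, T) \<in> component_equiv"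
  by (rule in_quotient_imp_in_rel[OF equiv_component_equiv Tc_quotient]) (auto intro: someI)

lemma tc_some: "l \<in> {1..n} \<Longrightarrow> x \<in> tc l \<Longrightarrow> (SOME x. x \<in> tc l, x) \<in> vertex_equiv"
  by (rule in_quotient_imp_in_rel[OF equiv_vertex_equiv tc_quotient]) (auto intro: someI)

lemma card_children_components:
  assumes "i \<in> {1..m}" "T \<in> Tc i" "j \<in> {1..m}"
  shows "card {Z \<in> Tc j. Z \<subseteq> parent_rel `` T} = component_incidence Tc i j"
  unfolding component_incidence_def
  using assms by (intro component_equiv_children_card[symmetric] Tc_some Tc_saturated Tc_components)

lemma card_component_class:
  assumes "i \<in> {1..m}" "T \<in> Tc i" "l \<in> {1..n}"
  shows "card {x \<in> T. x \<in> tc l} = class_representation Tc tc i l"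
  unfolding class_representation_def
  using assms by (intro component_equiv_vertex_card[symmetric] Tc_some tc_saturated)

lemma card_children_class:
  assumes "i \<in> {1..n}" "x \<in> tc i" "l \<in> {1..n}"
  shows "card {y \<in> tc l. (x, y) \<in> parent_rel} = vertex_incidence tc i l"
  unfolding vertex_incidence_def
  using assms by (intro vertex_equiv_children_card[symmetric] tc_some tc_saturated)

definition component_index :: "nat list set \<Rightarrow> nat" where
  "component_index T = (THE j. j \<in> {1..m} \<and> T \<in> Tc j)"

definition vertex_index :: "nat list \<Rightarrow> nat" where
  "vertex_index x = (THE l. l \<in> {1..n} \<and> x \<in> tc l)"

lemma ex1_component_index:
  assumes "T \<in> horizontal_components"
  shows "\<exists>!j. j \<in> {1..m} \<and> T \<in> Tc j"
proof -
  have refl: "(T, T) \<in> component_equiv"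
    using assms equiv_component_equiv by (simp add: equiv_class_eq_iff)
  have "component_equiv `` {T} \<in> Tc ` {1..m}"
    using assms bij_betw_imp_surj_on[OF bij_Tc] by (auto simp: component_classes_def intro: quotientI)
  then obtain j where j: "j \<in> {1..m}" "Tc j = component_equiv `` {T}" by auto
  then have "T \<in> Tc j" using assms equiv_class_self[OF equiv_component_equiv] by auto
  moreover have "j' = j" if "j' \<in> {1..m}" "T \<in> Tc j'" for j'
  proof -
    have "Tc j' = Tc j"
      using that j(1) \<open>T \<in> Tc j\<close> refl
      by (intro quotient_eqI[OF equiv_component_equiv Tc_quotient Tc_quotient])
    then show ?thesis using inj_onD[OF bij_betw_imp_inj_on[OF bij_Tc]] that j by blast
  qed
  ultimately show ?thesis using j by blast
qed

lemma ex1_vertex_index: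
  assumes "x \<in> vertices"
  shows "\<exists>!l. l \<in> {1..n} \<and> x \<in> tc l"
proof -
  have refl: "(x, x) \<in> vertex_equiv"
    using assms equiv_vertex_equiv by (simp add: equiv_class_eq_iff)
  have "vertex_equiv `` {x} \<in> tc ` {1..n}"
    using assms bij_betw_imp_surj_on[OF bij_tc] by (auto simp: vertex_classes_def intro: quotientI)
  then obtain l where l: "l \<in> {1..n}" "tc l = vertex_equiv `` {x}" by auto
  then have "x \<in> tc l" using assms equiv_class_self[OF equiv_vertex_equiv] by auto
  moreover have "l' = l" if "l' \<in> {1..n}" "x \<in> tc l'" for l'
  proof -
    have "tc l' = tc l"
      using that l(1) \<open>x \<in> tc l\<close> refl
      by (intro quotient_eqI[OF equiv_vertex_equiv tc_quotient tc_quotient])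
    then show ?thesis using inj_onD[OF bij_betw_imp_inj_on[OF bij_tc]] that l by blast
  qed
  ultimately show ?thesis using l by blast
qed

lemma component_index:
  assumes "T \<in> horizontal_components"
  shows "component_index T \<in> {1..m}" "T \<in> Tc (component_index T)"
    "\<And>j. j \<in> {1..m} \<Longrightarrow> T \<in> Tc j \<longleftrightarrow> component_index T = j"
  using theI'[OF ex1_component_index[OF assms]] ex1_component_index[OF assms]
  unfolding component_index_def[symmetric] by blast+

lemma vertex_index:
  assumes "x \<in> vertices"
  shows "vertex_index x \<in> {1..n}" "x \<in> tc (vertex_index x)"
    "\<And>l. l \<in> {1..n} \<Longrightarrow> x \<in> tc l \<longleftrightarrow> vertex_index x = l"
  using theI'[OF ex1_vertex_index[OF assms]] ex1_vertex_index[OF assms]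
  unfolding vertex_index_def[symmetric] by blast+

lemma children_index_eq:
  assumes "x \<in> level k" "l \<in> {1..n}"
  shows "{z \<in> level (Suc k). parent z = x \<and> vertex_index z = l} = {z \<in> tc l. (x, z) \<in> parent_rel}"
proof -
  have "z \<in> tc l \<longleftrightarrow> vertex_index z = l" if "z \<in> level (Suc k)" for z
    using vertex_index(3)[OF _ assms(2)] that by (auto simp: vertices_def)
  then show ?thesis using parent_rel_iff[OF assms(1)] by auto
qed

lemma component_card:
  assumes "T \<in> horizontal_components"
  shows "card T = (\<Sum>l=1..n. class_representation Tc tc (component_index T) l)"
proof -
  have V: "x \<in> vertices" if "x \<in> T" for x using that component_vertices[OF assms] by blast
  have "(\<Sum>l=1..n. \<Sum>x\<in>{x \<in> T. vertex_index x = l}. 1::nat) = (\<Sum>x\<in>T. 1)"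
    using vertex_index(1) V component_finite[OF assms] by (intro sum.group) auto
  then have "card T = (\<Sum>l=1..n. card {x \<in> T. vertex_index x = l})" by simp
  also have "\<dots> = (\<Sum>l=1..n. class_representation Tc tc (component_index T) l)"
  proof (intro sum.cong refl)
    fix l assume l: "l \<in> {1..n}"
    then have "{x \<in> T. vertex_index x = l} = {x \<in> T. x \<in> tc l}" using vertex_index(3) V by blast
    then show "card {x \<in> T. vertex_index x = l} = class_representation Tc tc (component_index T) l"
      using card_component_class[OF component_index(1,2)[OF assms] l] by simp
  qed
  finally show ?thesis .
qed

text \<open>
  The size of a component depends only on its class, and there are finitely many classes.
\<close>

lemma component_card_bounded: "\<exists>M. \<forall>T\<in>horizontal_components. card T \<le> M"
proof -
  have "card T \<le> (\<Sum>i=1..m. \<Sum>l=1..n. class_representation Tc tc i l)"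
    if "T \<in> horizontal_components" for T
    unfolding component_card[OF that]
    using component_index(1)[OF that] by (intro member_le_sum) auto
  then show ?thesis by blast
qed

text \<open>
  The row of \<open>A\<close> belonging to \<open>T\<close> is the sum of the \<open>p = card T\<close> rows of \<open>C\<close>, so the components of
  children of \<open>T\<close> split into \<open>p\<close> groups, the group \<open>s\<close> having \<open>C s j\<close> members of class \<open>j\<close>.  Its
  vertices are then distributed over the classes as the row \<open>\<phi> s\<close> of \<open>B\<close> prescribes, that is, like
  the children of a vertex of class \<open>\<phi> s\<close>.  As each class is the value of \<open>\<phi>\<close> as often as it occurs
  in \<open>T\<close>, the groups can be handed to the vertices of \<open>T\<close> bijectively with matching classes.
\<close>

lemma ex_component_rearrangement:
  assumes T: "T \<in> horizontal_components"
  shows "\<exists>h. (\<forall>z\<in>parent_rel `` T. h z \<in> T \<and> (\<forall>z'\<in>component_of z. h z' = h z)) \<and>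
    (\<forall>x\<in>T. \<forall>l\<in>{1..n}.
       card {z \<in> parent_rel `` T. h z = x \<and> z \<in> tc l} = card {z \<in> tc l. (x, z) \<in> parent_rel})"
proof -
  let ?A = "component_incidence Tc" and ?B = "vertex_incidence tc" and ?u = "class_representation Tc tc"
  define i where "i = component_index T"
  have i: "i \<in> {1..m}" "T \<in> Tc i" using component_index[OF T] by (auto simp: i_def)
  define p where "p = (\<Sum>l=1..n. ?u i l)"
  obtain C \<phi> where A: "\<And>j. j \<in> {1..m} \<Longrightarrow> ?A i j = (\<Sum>s=1..p. C s j)"
    and B: "\<And>s l. s \<in> {1..p} \<Longrightarrow> l \<in> {1..n} \<Longrightarrow> (\<Sum>j=1..m. C s j * ?u j l) = ?B (\<phi> s) l"
    and \<phi>: "\<And>s. s \<in> {1..p} \<Longrightarrow> \<phi> s \<in> {1..n}"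
    and u: "\<And>l. l \<in> {1..n} \<Longrightarrow> card {s \<in> {1..p}. \<phi> s = l} = ?u i l"
    using rearrangeable i unfolding rearrangeable_def Let_def p_def by blast

  \<comment> \<open>\<open>q\<close> gives the group of a component of children.\<close>
  define Ch where "Ch = {Z \<in> horizontal_components. Z \<subseteq> parent_rel `` T}"
  have fin_Ch: "finite Ch"
    unfolding Ch_def
    by (rule rev_finite_subset[OF finite_Pow_iff[THEN iffD2, OF finite_children[OF T]]]) auto
  have Ch_index: "{Z \<in> Ch. component_index Z = j} = {Z \<in> Tc j. Z \<subseteq> parent_rel `` T}" if "j \<in> {1..m}" for j
    using component_index(3)[OF _ that] Tc_components[OF that] by (auto simp: Ch_def)
  have "\<exists>q. (\<forall>Z\<in>{Z \<in> Ch. component_index Z = j}. q Z \<in> {1..p}) \<and>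
      (\<forall>s\<in>{1..p}. card {Z \<in> {Z \<in> Ch. component_index Z = j}. q Z = s} = C s j)" if "j \<in> {1..m}" for j
  proof (rule ex_function_with_fibre_cards)
    show "card {Z \<in> Ch. component_index Z = j} = (\<Sum>s=1..p. C s j)"
      unfolding Ch_index[OF that] card_children_components[OF i that] A[OF that] ..
  qed (use fin_Ch in auto)
  then have "\<exists>q0. \<forall>j\<in>{1..m}. (\<forall>Z\<in>{Z \<in> Ch. component_index Z = j}. q0 j Z \<in> {1..p}) \<and>
      (\<forall>s\<in>{1..p}. card {Z \<in> {Z \<in> Ch. component_index Z = j}. q0 j Z = s} = C s j)"
    by (intro bchoice) blast
  then obtain q0 where "\<forall>j\<in>{1..m}. (\<forall>Z\<in>{Z \<in> Ch. component_index Z = j}. q0 j Z \<in> {1..p}) \<and>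
      (\<forall>s\<in>{1..p}. card {Z \<in> {Z \<in> Ch. component_index Z = j}. q0 j Z = s} = C s j)" ..
  then have q0: "\<And>j Z. j \<in> {1..m} \<Longrightarrow> Z \<in> Ch \<Longrightarrow> component_index Z = j \<Longrightarrow> q0 j Z \<in> {1..p}"
    "\<And>j s. j \<in> {1..m} \<Longrightarrow> s \<in> {1..p} \<Longrightarrow>
      card {Z \<in> {Z \<in> Ch. component_index Z = j}. q0 j Z = s} = C s j"
    by blast+
  define q where "q Z = q0 (component_index Z) Z" for Z
  have q: "q Z \<in> {1..p}" if "Z \<in> Ch" for Z
    using q0(1)[of "component_index Z" Z] component_index(1)[of Z] that by (auto simp: q_def Ch_def)
  have q_card: "card {Z \<in> {Z \<in> Ch. q Z = s}. component_index Z = j} = C s j"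
    if "j \<in> {1..m}" "s \<in> {1..p}" for j s
    unfolding q0(2)[OF that, symmetric] by (rule arg_cong[of _ _ card]) (auto simp: q_def)

  have V: "x \<in> vertices" if "x \<in> T" for x using that component_vertices[OF T] by blast
  \<comment> \<open>\<open>e\<close> gives the group that a vertex of \<open>T\<close> receives.\<close>
  have "\<exists>e. bij_betw e T {1..p} \<and> (\<forall>x\<in>T. \<phi> (e x) = vertex_index x)"
  proof (rule ex_bij_betw_same_fibres)
    fix l
    show "card {x \<in> T. vertex_index x = l} = card {s \<in> {1..p}. \<phi> s = l}"
    proof (cases "l \<in> {1..n}")
      case True
      then have "{x \<in> T. vertex_index x = l} = {x \<in> T. x \<in> tc l}" using vertex_index(3) V by blast
      then show ?thesis using u[OF True] card_component_class[OF i True] by simp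
    next
      case False
      then have empty: "{x \<in> T. vertex_index x = l} = {}" "{s \<in> {1..p}. \<phi> s = l} = {}"
        using vertex_index(1) V \<phi> by blast+
      show ?thesis unfolding empty by simp
    qed
  qed (use component_finite[OF T] in auto)
  then obtain e where e: "bij_betw e T {1..p}" "\<And>x. x \<in> T \<Longrightarrow> \<phi> (e x) = vertex_index x" by blast

  define h where "h z = inv_into T e (q (component_of z))" for z
  have child_Ch: "component_of z \<in> Ch" if "z \<in> parent_rel `` T" for z
    using that component_of_children[OF T that] component_of_in parent_rel_vertices unfolding Ch_def by blast
  have h_T: "h z \<in> T" if "z \<in> parent_rel `` T" for z
    unfolding h_def using bij_betwE[OF bij_betw_inv_into[OF e(1)]] q[OF child_Ch[OF that]] by blast
  have h_eq: "h z = x \<longleftrightarrow> q (component_of z) = e x" if "z \<in> parent_rel `` T" "x \<in> T" for z x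
    unfolding h_def using q[OF child_Ch[OF that(1)]] that(2) e(1)
    by (metis bij_betw_inv_into_left bij_betw_inv_into_right)
  have "card {z \<in> parent_rel `` T. h z = x \<and> z \<in> tc l} = card {z \<in> tc l. (x, z) \<in> parent_rel}"
    if x: "x \<in> T" and l: "l \<in> {1..n}" for x l
  proof -
    let ?s = "e x"
    have s: "?s \<in> {1..p}" using bij_betwE[OF e(1)] x by blast
    let ?Ch = "{Z \<in> Ch. q Z = ?s}"
    have "{z \<in> parent_rel `` T. h z = x \<and> z \<in> tc l} = (\<Union>Z\<in>?Ch. {z \<in> Z. z \<in> tc l})"
    proof (intro equalityI subsetI)
      fix z assume "z \<in> {z \<in> parent_rel `` T. h z = x \<and> z \<in> tc l}"
      then show "z \<in> (\<Union>Z\<in>?Ch. {z \<in> Z. z \<in> tc l})"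
        using h_eq[of z x] child_Ch[of z] x by (auto intro!: bexI[of _ "component_of z"])
    next
      fix z assume "z \<in> (\<Union>Z\<in>?Ch. {z \<in> Z. z \<in> tc l})"
      then obtain Z where Z: "Z \<in> Ch" "q Z = ?s" "z \<in> Z" "z \<in> tc l" by blast
      then have "Z = component_of z" "z \<in> parent_rel `` T"
        using component_eq_component_of by (auto simp: Ch_def)
      then show "z \<in> {z \<in> parent_rel `` T. h z = x \<and> z \<in> tc l}"
        using h_eq[of z x] x Z by auto
    qed
    then have "card {z \<in> parent_rel `` T. h z = x \<and> z \<in> tc l} = card (\<Union>Z\<in>?Ch. {z \<in> Z. z \<in> tc l})"
      by simp
    also have "\<dots> = (\<Sum>Z\<in>?Ch. card {z \<in> Z. z \<in> tc l})"
    proof (rule card_UN_disjoint)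
      show "finite ?Ch" using fin_Ch by simp
      show "\<forall>Z\<in>?Ch. finite {z \<in> Z. z \<in> tc l}" using component_finite by (simp add: Ch_def)
      show "\<forall>Z\<in>?Ch. \<forall>Z'\<in>?Ch. Z \<noteq> Z' \<longrightarrow> {z \<in> Z. z \<in> tc l} \<inter> {z \<in> Z'. z \<in> tc l} = {}"
        using component_eq_component_of unfolding Ch_def by blast
    qed
    also have "\<dots> = (\<Sum>Z\<in>?Ch. ?u (component_index Z) l)"
      using card_component_class[OF _ _ l] component_index by (intro sum.cong refl) (simp add: Ch_def)
    also have "\<dots> = (\<Sum>j=1..m. \<Sum>Z\<in>{Z \<in> ?Ch. component_index Z = j}. ?u (component_index Z) l)"
    proof (rule sum.group[symmetric])
      show "finite ?Ch" using fin_Ch by simp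
      show "component_index ` ?Ch \<subseteq> {1..m}" using component_index(1) by (auto simp: Ch_def)
    qed simp
    also have "\<dots> = (\<Sum>j=1..m. C ?s j * ?u j l)"
      using q_card[OF _ s] by (intro sum.cong refl) simp
    also have "\<dots> = ?B (vertex_index x) l" using B[OF s l] e(2)[OF x] by simp
    also have "\<dots> = card {z \<in> tc l. (x, z) \<in> parent_rel}"
      using card_children_class[OF vertex_index(1,2)[OF V[OF x]] l] by simp
    finally show ?thesis .
  qed
  moreover have "\<forall>z'\<in>component_of z. h z' = h z" for z
    unfolding h_def using component_of_eq_iff by metis
  ultimately show ?thesis using h_T by blast
qed

text \<open>
  Gluing the rearrangements of all components gives a second parent function, which is constant on
  components and under which every vertex has as many children of each class as before.
\<close>

lemma rearranged_parent:
  obtains h where "\<And>k z. z \<in> level (Suc k) \<Longrightarrow> h z \<in> component_of (parent z)"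
    and "\<And>k z z'. z \<in> level (Suc k) \<Longrightarrow> z' \<in> component_of z \<Longrightarrow> h z' = h z"
    and "\<And>k x l. x \<in> level k \<Longrightarrow>
       card {z \<in> level (Suc k). h z = x \<and> vertex_index z = l} =
       card {z \<in> level (Suc k). parent z = x \<and> vertex_index z = l}"
proof -
  have "\<exists>H. \<forall>T\<in>horizontal_components.
      (\<forall>z\<in>parent_rel `` T. H T z \<in> T \<and> (\<forall>z'\<in>component_of z. H T z' = H T z)) \<and>
      (\<forall>x\<in>T. \<forall>l\<in>{1..n}.
        card {z \<in> parent_rel `` T. H T z = x \<and> z \<in> tc l} = card {z \<in> tc l. (x, z) \<in> parent_rel})"
    by (rule bchoice) (rule ballI[OF ex_component_rearrangement])
  then obtain H where HT: "\<forall>T\<in>horizontal_components.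
      (\<forall>z\<in>parent_rel `` T. H T z \<in> T \<and> (\<forall>z'\<in>component_of z. H T z' = H T z)) \<and>
      (\<forall>x\<in>T. \<forall>l\<in>{1..n}.
        card {z \<in> parent_rel `` T. H T z = x \<and> z \<in> tc l} = card {z \<in> tc l. (x, z) \<in> parent_rel})"
    ..
  note H = bspec[OF conjunct1[OF bspec[OF HT]]] and card = bspec[OF bspec[OF conjunct2[OF bspec[OF HT]]]]
  define h where "h z = H (component_of (parent z)) z" for z
  have V: "z \<in> vertices" if "z \<in> level k" for z k using that by (auto simp: vertices_def)
  have mem: "h z \<in> component_of (parent z) \<and> (\<forall>z'\<in>component_of z. h z' = h z)"
    if z: "z \<in> level (Suc k)" for k z
  proof -
    let ?T = "component_of (parent z)"
    have "?T \<in> horizontal_components" using parent_level[OF z] V component_of_in by blast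
    moreover have "z \<in> parent_rel `` ?T" using parent_in_rel[OF z] by (meson ImageI component_of_self)
    ultimately have Hz: "H ?T z \<in> ?T" "\<forall>z'\<in>component_of z. H ?T z' = H ?T z" using H by blast+
    have "component_of (parent z') = ?T" if "z' \<in> component_of z" for z'
      using component_of_parent[OF z, of z'] that component_of_eq_iff[of z z'] by metis
    then show ?thesis using Hz unfolding h_def by metis
  qed
  have h_card: "card {z \<in> level (Suc k). h z = x \<and> vertex_index z = l} =
       card {z \<in> level (Suc k). parent z = x \<and> vertex_index z = l}"
    if x: "x \<in> level k" for k x l
  proof (cases "l \<in> {1..n}")
    case True
    let ?T = "component_of x"
    have T: "?T \<in> horizontal_components" using x V component_of_in by blast
    note children = children_iff[OF T component_of_level[OF x]]
    have "{z \<in> level (Suc k). h z = x \<and> vertex_index z = l} =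
        {z \<in> parent_rel `` ?T. H ?T z = x \<and> z \<in> tc l}"
    proof (intro equalityI subsetI)
      fix z assume "z \<in> {z \<in> level (Suc k). h z = x \<and> vertex_index z = l}"
      then have z: "z \<in> level (Suc k)" "h z = x" "vertex_index z = l" by auto
      then have "component_of (parent z) = ?T" using mem[OF z(1)] component_of_eq_iff by metis
      then show "z \<in> {z \<in> parent_rel `` ?T. H ?T z = x \<and> z \<in> tc l}"
        using z children[of z] vertex_index(3)[OF V[OF z(1)] True] unfolding h_def mem_Collect_eq by metis
    next
      fix z assume "z \<in> {z \<in> parent_rel `` ?T. H ?T z = x \<and> z \<in> tc l}"
      then have z: "z \<in> level (Suc k)" "component_of (parent z) = ?T" "H ?T z = x" "z \<in> tc l"
        using children by blast+
      then show "z \<in> {z \<in> level (Suc k). h z = x \<and> vertex_index z = l}"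
        using vertex_index(3)[OF V[OF z(1)] True] unfolding h_def by simp
    qed
    moreover have "{z \<in> level (Suc k). parent z = x \<and> vertex_index z = l} = {z \<in> tc l. (x, z) \<in> parent_rel}"
      using children_index_eq[OF x True] .
    ultimately show ?thesis using card[OF T _ True, of x] by simp
  next
    case False
    then have "{z \<in> level (Suc k). vertex_index z = l} = {}" using vertex_index(1) V by blast
    then have empty: "{z \<in> level (Suc k). h z = x \<and> vertex_index z = l} = {}"
      "{z \<in> level (Suc k). parent z = x \<and> vertex_index z = l} = {}" by auto
    show ?thesis unfolding empty ..
  qed
  show thesis
    by (rule that[of h, OF conjunct1[OF mem] bspec[OF conjunct2[OF mem]] h_card])
qed

end

section \<open>A level-preserving near-isometry\<close>

context augmented_tree
begin

definition ancestor :: "nat \<Rightarrow> nat list \<Rightarrow> nat list" where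
  "ancestor k x = (parent ^^ (depth x - k)) x"

lemma funpow_parent_level: "x \<in> level (k + i) \<Longrightarrow> (parent ^^ i) x \<in> level k"
proof (induction i arbitrary: k)
  case (Suc i)
  then have "(parent ^^ i) x \<in> level (Suc k)" by simp
  then show ?case using parent_level by simp
qed simp

lemma ancestor_level: "x \<in> vertices \<Longrightarrow> k \<le> depth x \<Longrightarrow> ancestor k x \<in> level k"
  unfolding ancestor_def using level_depth by (intro funpow_parent_level) simp

lemma component_of_funpow_parent:
  "x \<in> level (k + i) \<Longrightarrow> component_of x = component_of y \<Longrightarrow>
     component_of ((parent ^^ i) x) = component_of ((parent ^^ i) y)"
proof (induction i arbitrary: k)
  case (Suc i)
  then have "(parent ^^ i) x \<in> level (Suc k)" by (intro funpow_parent_level) simp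
  moreover have "component_of ((parent ^^ i) x) = component_of ((parent ^^ i) y)"
    using Suc.prems by (intro Suc.IH[of "Suc k"]) simp_all
  ultimately show ?case using component_of_parent by simp
qed simp

lemma vertical_cases:
  assumes "(x, y) \<in> vertical_edges"
  obtains "x \<in> level (depth x)" "y \<in> level (Suc (depth x))" "depth y = Suc (depth x)" "x = parent y"
  | "y \<in> level (depth y)" "x \<in> level (Suc (depth y))" "depth x = Suc (depth y)" "y = parent x"
proof -
  have *: "v \<in> level (depth v) \<and> w \<in> level (Suc (depth v)) \<and> depth w = Suc (depth v) \<and> v = parent w"
    if "(v, w) \<in> parent_rel" for v w
    using parent_eq[OF that] parent_rel_vertices[OF that] level_depth parent_rel_level[OF that] depth_eq
    by metis
  show thesis using assms * that unfolding vertical_edges_def by blast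
qed

lemma ancestor_parent:
  assumes "y \<in> level (Suc j)" "k \<le> j"
  shows "ancestor k (parent y) = ancestor k y"
proof -
  have "Suc j - k = Suc (j - k)" using assms(2) by simp
  then show ?thesis
    unfolding ancestor_def depth_eq[OF assms(1)] depth_eq[OF parent_level[OF assms(1)]]
    by (simp add: funpow_swap1)
qed

lemma vertical_ancestor:
  assumes "(x, y) \<in> vertical_edges" "k \<le> depth x" "k \<le> depth y"
  shows "ancestor k x = ancestor k y"
  using assms(1)
proof (cases rule: vertical_cases)
  case 1
  then show ?thesis using assms(2) ancestor_parent[of y "depth x" k] by metis
next
  case 2
  then show ?thesis using assms(3) ancestor_parent[of x "depth y" k] by metis
qed

lemma vertical_depth:
  assumes "(x, y) \<in> vertical_edges"
  shows "depth y \<le> Suc (depth x) \<and> depth x \<le> Suc (depth y)"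
  using assms by (cases rule: vertical_cases) auto

lemma horizontal_depth:
  assumes "(x, y) \<in> horizontal_edges"
  shows "x \<in> level (depth x) \<and> depth y = depth x"
proof -
  obtain k where "x \<in> level k" "y \<in> level k" using assms by (auto simp: horizontal_edges_def)
  then show ?thesis using depth_eq by metis
qed

lemma horizontal_ancestor:
  assumes "(x, y) \<in> horizontal_edges" "k \<le> depth x"
  shows "component_of (ancestor k x) = component_of (ancestor k y)"
  using component_of_funpow_parent[of x k "depth x - k" y] horizontal_depth[OF assms(1)]
    component_of_edge[OF assms(1)] assms(2) unfolding ancestor_def by simp

lemma vertical_path_meet:
  assumes "(x, y) \<in> vertical_edges ^^ l"
  shows "\<exists>k. k \<le> depth x \<and> k \<le> depth y \<and> ancestor k x = ancestor k y \<and>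
    depth x + depth y \<le> l + 2 * k"
  using path_meet[of vertical_edges depth ancestor, OF vertical_depth vertical_ancestor assms] by blast

lemma path_meet_component:
  assumes "(x, y) \<in> edges ^^ l"
  shows "\<exists>k. k \<le> depth x \<and> k \<le> depth y \<and> component_of (ancestor k x) = component_of (ancestor k y) \<and>
    depth x + depth y \<le> l + 2 * k"
proof -
  have "depth y \<le> Suc (depth x) \<and> depth x \<le> Suc (depth y)" if "(x, y) \<in> edges" for x y
    using that vertical_depth horizontal_depth[of x y] unfolding edges_def by auto
  moreover have "component_of (ancestor k x) = component_of (ancestor k y)"
    if "(x, y) \<in> edges" "k \<le> depth x" "k \<le> depth y" for x y k
    using that vertical_ancestor[of x y k] horizontal_ancestor[of x y k] unfolding edges_def by auto
  ultimately show ?thesis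
    using path_meet[of edges depth "\<lambda>k x. component_of (ancestor k x)", OF _ _ assms] by blast
qed

lemma sym_vertical: "sym vertical_edges"
  unfolding vertical_edges_def by (auto simp: sym_def)

lemma sym_edges: "sym edges"
  unfolding edges_def using sym_vertical sym_horizontal by (auto simp: sym_def)

lemma path_to_funpow_parent: "x \<in> level (k + i) \<Longrightarrow> (x, (parent ^^ i) x) \<in> vertical_edges ^^ i"
proof (induction i arbitrary: k)
  case (Suc i)
  then have "(parent ^^ i) x \<in> level (Suc k)" by (intro funpow_parent_level) simp
  then have "((parent ^^ i) x, parent ((parent ^^ i) x)) \<in> vertical_edges"
    using parent_in_rel by (auto simp: vertical_edges_def)
  then show ?case using Suc.IH[of "Suc k"] Suc.prems by auto
qed simp

lemma path_to_ancestor: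
  assumes "x \<in> vertices" "k \<le> depth x"
  shows "(x, ancestor k x) \<in> vertical_edges ^^ (depth x - k)"
  unfolding ancestor_def using assms level_depth by (intro path_to_funpow_parent[of x k]) simp

lemma vertical_connected:
  assumes "x \<in> vertices" "y \<in> vertices"
  shows "(x, y) \<in> vertical_edges\<^sup>*"
proof -
  have root: "(x, []) \<in> vertical_edges\<^sup>*" if "x \<in> vertices" for x
    using path_to_ancestor[OF that, of 0] ancestor_level[OF that, of 0] by (auto dest: relpow_imp_rtrancl)
  then show ?thesis
    using assms symD[OF sym_rtrancl[OF sym_vertical]] by (meson rtrancl_trans)
qed

lemma edges_connected:
  assumes "x \<in> vertices" "y \<in> vertices"
  shows "(x, y) \<in> edges\<^sup>*"
  using vertical_connected[OF assms] rtrancl_mono[of vertical_edges edges] by (auto simp: edges_def)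

lemma vertical_dist_le:
  assumes "x \<in> vertices" "y \<in> vertices" "k \<le> depth x" "k \<le> depth y" "ancestor k x = ancestor k y"
  shows "graph_dist vertical_edges x y \<le> (depth x - k) + (depth y - k)"
  using path_to_ancestor[OF assms(1,3)] relpow_sym[OF sym_vertical path_to_ancestor[OF assms(2,4)]] assms(5)
  by (intro graph_dist_le) (auto simp: relpow_add)

text \<open>
  A shortest path inside a component has at most as many steps as the component has edges, of which
  there are at most \<open>M * M\<close> as ordered pairs.
\<close>

lemma path_in_component:
  assumes "u \<in> vertices" and eq: "component_of u = component_of v" and "card (component_of u) \<le> M"
  shows "\<exists>l\<le>M * M. (u, v) \<in> edges ^^ l"
proof -
  let ?T = "component_of u"
  let ?H = "horizontal_edges \<inter> ?T \<times> ?T"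
  have fin: "finite ?T" using component_finite component_of_in assms(1) by blast
  have "card ?H \<le> card (?T \<times> ?T)" using fin by (intro card_mono) auto
  also have "\<dots> \<le> M * M" using assms(3) by (simp add: card_cartesian_product mult_le_mono)
  finally have card: "card ?H \<le> M * M" .
  have "v \<in> ?T" unfolding eq by (rule component_of_self)
  then have "(u, v) \<in> ?H\<^sup>*"
    using horizontally_connected_component_of[of u] component_of_self[of u]
    unfolding horizontally_connected_def by blast
  moreover have "finite ?H" using fin by (intro finite_subset[of ?H "?T \<times> ?T"]) auto
  ultimately obtain l where l: "l \<le> card ?H" "(u, v) \<in> ?H ^^ l"
    using rtrancl_finite_eq_relpow[of ?H] by auto
  have "?H \<subseteq> edges" by (auto simp: edges_def)
  then have "(u, v) \<in> edges ^^ l" using l(2) relpow_mono by blast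
  then show ?thesis using l(1) card order_trans by blast
qed

lemma edges_dist_le:
  assumes xy: "x \<in> vertices" "y \<in> vertices" and k: "k \<le> depth x" "k \<le> depth y"
    and eq: "component_of (ancestor k x) = component_of (ancestor k y)"
    and M: "card (component_of (ancestor k x)) \<le> M"
  shows "graph_dist edges x y \<le> (depth x - k) + M * M + (depth y - k)"
proof -
  have "ancestor k x \<in> vertices" using ancestor_level xy k by (auto simp: vertices_def)
  from path_in_component[OF this eq M] obtain l where
    l: "l \<le> M * M" "(ancestor k x, ancestor k y) \<in> edges ^^ l" by blast
  have sub: "vertical_edges \<subseteq> edges" by (auto simp: edges_def)
  have "(x, ancestor k x) \<in> edges ^^ (depth x - k)" "(ancestor k y, y) \<in> edges ^^ (depth y - k)"
    using path_to_ancestor[OF xy(1) k(1)] relpow_sym[OF sym_vertical path_to_ancestor[OF xy(2) k(2)]]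
      relpow_mono[OF sub] by blast+
  with l(2) have "(x, y) \<in> edges ^^ ((depth x - k) + l + (depth y - k))"
    unfolding relpow_add by blast
  then show ?thesis using graph_dist_le l(1) by (meson add_le_mono le_refl order_trans)
qed

end

context rearrangeable_augmented_tree
begin

lemma card_children_index:
  assumes x: "x \<in> level k"
  shows "card {z \<in> level (Suc k). parent z = x \<and> vertex_index z = l} =
    (if l \<in> {1..n} then vertex_incidence tc (vertex_index x) l else 0)"
proof (cases "l \<in> {1..n}")
  case True
  have "x \<in> vertices" using x by (auto simp: vertices_def)
  then show ?thesis
    using card_children_class[OF vertex_index(1,2) True] children_index_eq[OF x True] True by simp
next
  case False
  have "vertex_index z \<noteq> l" if "z \<in> level (Suc k)" for z
    using vertex_index(1)[of z] that False by (auto simp: vertices_def)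
  then have empty: "{z \<in> level (Suc k). parent z = x \<and> vertex_index z = l} = {}" by blast
  show ?thesis unfolding empty if_not_P[OF False] by simp
qed

text \<open>
  The map \<open>F k\<close> on level \<open>k\<close> preserves vertex classes, which fix the numbers of children of each
  class.  Therefore the vertices of the next level with new parent \<open>x\<close> can be mapped to the children
  of \<open>F k x\<close> by a bijection that again preserves classes, and the recursion continues.
\<close>

lemma ex_level_bijections:
  assumes h_level: "\<And>k z. z \<in> level (Suc k) \<Longrightarrow> h z \<in> level k"
    and h_card: "\<And>k x l. x \<in> level k \<Longrightarrow>
       card {z \<in> level (Suc k). h z = x \<and> vertex_index z = l} =
       card {z \<in> level (Suc k). parent z = x \<and> vertex_index z = l}"
  shows "\<exists>F. \<forall>k. bij_betw (F k) (level k) (level k) \<and>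
    (\<forall>z\<in>level (Suc k). parent (F (Suc k) z) = F k (h z))"
proof -
  define P where "P k f \<longleftrightarrow> bij_betw f (level k) (level k) \<and> (\<forall>x\<in>level k. vertex_index (f x) = vertex_index x)"
    for k and f :: "nat list \<Rightarrow> nat list"
  have "\<exists>F. \<forall>k. P k (F k) \<and> (\<forall>z\<in>level (Suc k). parent (F (Suc k) z) = F k (h z))"
  proof (rule dependent_nat_choice)
    show "\<exists>f. P 0 f" by (rule exI[of _ id]) (simp add: P_def)
  next
    fix f k assume "P k f"
    then have f: "bij_betw f (level k) (level k)" and index: "\<And>x. x \<in> level k \<Longrightarrow> vertex_index (f x) = vertex_index x"
      by (auto simp: P_def)
    let ?L = "level (Suc k)"
    have "card {z \<in> ?L. (f (h z), vertex_index z) = yl} = card {w \<in> ?L. (parent w, vertex_index w) = yl}" for yl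
    proof -
      obtain y l where yl: "yl = (y, l)" by (cases yl)
      show ?thesis
      proof (cases "y \<in> level k")
        case True
        then obtain x where x: "x \<in> level k" "y = f x" using bij_betw_imp_surj_on[OF f] by blast
        have "{z \<in> ?L. (f (h z), vertex_index z) = yl} = {z \<in> ?L. h z = x \<and> vertex_index z = l}"
          using x h_level bij_betw_imp_inj_on[OF f] by (auto simp: yl dest: inj_onD)
        also have "card \<dots> = card {w \<in> ?L. parent w = y \<and> vertex_index w = l}"
          unfolding h_card[OF x(1)] card_children_index[OF x(1)] card_children_index[OF True]
          using index[OF x(1)] x(2) by simp
        finally show ?thesis by (simp add: yl)
      next
        case False
        then have empty: "{z \<in> ?L. (f (h z), vertex_index z) = yl} = {}"
          "{w \<in> ?L. (parent w, vertex_index w) = yl} = {}"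
          using h_level bij_betwE[OF f] parent_level by (auto simp: yl)
        show ?thesis unfolding empty by simp
      qed
    qed
    then have "\<exists>g. bij_betw g ?L ?L \<and> (\<forall>z\<in>?L. (parent (g z), vertex_index (g z)) = (f (h z), vertex_index z))"
      by (intro ex_bij_betw_same_fibres finite_level)
    then show "\<exists>g. P (Suc k) g \<and> (\<forall>z\<in>?L. parent (g z) = f (h z))"
      unfolding P_def by auto
  qed
  then show ?thesis unfolding P_def by blast
qed

text \<open>
  The isomorphism \<open>\<sigma>\<close> takes new ancestors \<open>anc k x\<close> to ordinary ancestors of \<open>\<sigma> x\<close>, and \<open>anc k x\<close> lies
  in the component of the ordinary ancestor of \<open>x\<close>.  Thus the levels at which ancestors agree in
  the two graphs can be compared.
\<close>

theorem ex_near_isometry: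
  "\<exists>\<sigma>. near_isometry vertices edges vertices vertical_edges \<sigma>"
proof -
  obtain h where h: "\<And>k z. z \<in> level (Suc k) \<Longrightarrow> h z \<in> component_of (parent z)"
    and h_const: "\<And>k z z'. z \<in> level (Suc k) \<Longrightarrow> z' \<in> component_of z \<Longrightarrow> h z' = h z"
    and h_card: "\<And>k x l. x \<in> level k \<Longrightarrow>
       card {z \<in> level (Suc k). h z = x \<and> vertex_index z = l} =
       card {z \<in> level (Suc k). parent z = x \<and> vertex_index z = l}"
    by (rule rearranged_parent) (rule that)
  have h_level: "h z \<in> level k" if "z \<in> level (Suc k)" for z k
    using h[OF that] component_of_level[OF parent_level[OF that]] by blast
  obtain F where F: "\<And>k. bij_betw (F k) (level k) (level k)"
    and F_parent: "\<And>k z. z \<in> level (Suc k) \<Longrightarrow> parent (F (Suc k) z) = F k (h z)"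
    using ex_level_bijections[of h, OF h_level h_card] by blast
  obtain M where M: "\<And>T. T \<in> horizontal_components \<Longrightarrow> card T \<le> M"
    using component_card_bounded by blast
  define \<sigma> where "\<sigma> x = F (depth x) x" for x
  have \<sigma>_level: "\<sigma> x \<in> level k" if "x \<in> level k" for x k
    using bij_betwE[OF F] that depth_eq[OF that] by (simp add: \<sigma>_def)
  have \<sigma>_depth: "depth (\<sigma> x) = depth x" if "x \<in> vertices" for x
    using \<sigma>_level[OF level_depth[OF that]] depth_eq by blast
  have \<sigma>_V: "\<sigma> x \<in> vertices" if "x \<in> vertices" for x
    using \<sigma>_level[OF level_depth[OF that]] by (auto simp: vertices_def)
  have inj: "x = y" if "x \<in> vertices" "y \<in> vertices" "\<sigma> x = \<sigma> y" for x y
  proof -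
    have "depth x = depth y" using \<sigma>_depth that by metis
    then show ?thesis
      using that(3) level_depth[OF that(1)] level_depth[OF that(2)] bij_betw_imp_inj_on[OF F[of "depth x"]]
      by (auto simp: \<sigma>_def dest: inj_onD)
  qed
  have "y \<in> \<sigma> ` vertices" if y: "y \<in> vertices" for y
  proof -
    have "y \<in> F (depth y) ` level (depth y)"
      unfolding bij_betw_imp_surj_on[OF F] by (rule level_depth[OF y])
    then obtain x where x: "x \<in> level (depth y)" "F (depth y) x = y" by (metis imageE)
    then have "\<sigma> x = y" "x \<in> vertices" by (auto simp: \<sigma>_def depth_eq vertices_def)
    then show ?thesis by blast
  qed
  then have bij: "bij_betw \<sigma> vertices vertices"
    using inj \<sigma>_V unfolding bij_betw_def by (blast intro: inj_onI)

  define anc where "anc k x = (h ^^ (depth x - k)) x" for k x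
  have funpow_h: "(h ^^ i) x \<in> level k \<and> component_of ((h ^^ i) x) = component_of ((parent ^^ i) x) \<and>
      (parent ^^ i) (\<sigma> x) = \<sigma> ((h ^^ i) x)" if "x \<in> level (k + i)" for x k i
    using that
  proof (induction i arbitrary: k)
    case (Suc i)
    define w where "w = (h ^^ i) x"
    have w: "w \<in> level (Suc k)" "component_of w = component_of ((parent ^^ i) x)"
      "(parent ^^ i) (\<sigma> x) = \<sigma> w"
      using Suc.IH[of "Suc k"] Suc.prems by (auto simp: w_def)
    have "component_of (h w) = component_of (parent w)"
      using h[OF w(1)] component_of_eq_iff by metis
    then show ?case
      using h_level[OF w(1)] component_of_parent[OF w(1,2)] w F_parent[OF w(1)]
      by (simp add: w_def[symmetric] \<sigma>_def depth_eq)
  qed simp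
  have anc: "anc k x \<in> level k" "component_of (anc k x) = component_of (ancestor k x)"
    "ancestor k (\<sigma> x) = \<sigma> (anc k x)" if "x \<in> vertices" "k \<le> depth x" for x k
    using funpow_h[of x k "depth x - k"] level_depth that \<sigma>_depth[OF that(1)]
    by (auto simp: anc_def ancestor_def)

  have le1: "graph_dist vertical_edges (\<sigma> x) (\<sigma> y) \<le> graph_dist edges x y + 2"
    if xy: "x \<in> vertices" "y \<in> vertices" for x y
  proof -
    obtain k where k: "k \<le> depth x" "k \<le> depth y"
      "component_of (ancestor k x) = component_of (ancestor k y)"
      "depth x + depth y \<le> graph_dist edges x y + 2 * k"
      using path_meet_component[OF graph_dist_path[OF edges_connected[OF xy]]] by blast
    \<comment> \<open>Vertices of one component are siblings in the new tree, so one more step up suffices; at level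
      0 the truncated subtraction is harmless since there is only the root.\<close>
    have "anc (k - 1) x = anc (k - 1) y"
    proof (cases k)
      case 0
      then show ?thesis using anc(1)[OF xy(1), of 0] anc(1)[OF xy(2), of 0] by simp
    next
      case (Suc j)
      have "anc (k - 1) z = h (anc k z)" if "k \<le> depth z" for z
      proof -
        have "depth z - (k - 1) = Suc (depth z - k)" using that Suc by simp
        then show ?thesis by (simp add: anc_def)
      qed
      moreover have "anc k y \<in> component_of (anc k x)"
        using anc(2) xy k component_of_eq_iff by metis
      ultimately show ?thesis using h_const[of "anc k x" j "anc k y"] anc(1)[OF xy(1) k(1)] k Suc by simp
    qed
    then have "ancestor (k - 1) (\<sigma> x) = ancestor (k - 1) (\<sigma> y)"
      using anc(3)[of x "k - 1"] anc(3)[of y "k - 1"] xy k by simp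
    then have "graph_dist vertical_edges (\<sigma> x) (\<sigma> y) \<le> (depth x - (k - 1)) + (depth y - (k - 1))"
      using vertical_dist_le[OF \<sigma>_V[OF xy(1)] \<sigma>_V[OF xy(2)], of "k - 1"] \<sigma>_depth xy k by simp
    then show ?thesis using k by linarith
  qed
  have le2: "graph_dist edges x y \<le> graph_dist vertical_edges (\<sigma> x) (\<sigma> y) + M * M"
    if xy: "x \<in> vertices" "y \<in> vertices" for x y
  proof -
    obtain k where k: "k \<le> depth x" "k \<le> depth y" "ancestor k (\<sigma> x) = ancestor k (\<sigma> y)"
      "depth x + depth y \<le> graph_dist vertical_edges (\<sigma> x) (\<sigma> y) + 2 * k"
      using vertical_path_meet[OF graph_dist_path[OF vertical_connected[OF \<sigma>_V[OF xy(1)] \<sigma>_V[OF xy(2)]]]]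
        \<sigma>_depth xy by auto
    have V: "z \<in> vertices" if "z \<in> level k" for z using that by (auto simp: vertices_def)
    have "anc k x = anc k y"
      using inj[OF V V] anc(1,3) xy k by metis
    then have "component_of (ancestor k x) = component_of (ancestor k y)" using anc(2) xy k by metis
    moreover have "card (component_of (ancestor k x)) \<le> M"
      using M component_of_in V ancestor_level xy k by blast
    ultimately have "graph_dist edges x y \<le> (depth x - k) + M * M + (depth y - k)"
      using edges_dist_le xy k by blast
    then show ?thesis using k by linarith
  qed
  have "\<bar>real (graph_dist vertical_edges (\<sigma> x) (\<sigma> y)) - real (graph_dist edges x y)\<bar> < real (M * M + 3)"
    if "x \<in> vertices" "y \<in> vertices" for x y
    using le1[OF that] le2[OF that] by linarith
  moreover have "0 < real (M * M + 3)" unfolding of_nat_0_less_iff by simp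
  ultimately show ?thesis
    unfolding near_isometry_def using bij by (intro exI[of _ \<sigma>] conjI exI[of _ "real (M * M + 3)"]) auto
qed

end

theorem theorem1p1:
  fixes N :: nat
    and S :: "nat \<Rightarrow> real ^ 'd \<Rightarrow> real ^ 'd"
    and ratio :: "nat \<Rightarrow> real"
    and K :: "(real ^ 'd) set"
    and kappa :: real
    and m n :: nat
    and Tc :: "nat \<Rightarrow> nat list set set"
    and tc :: "nat \<Rightarrow> nat list set"
  assumes "augmented_tree N S ratio K kappa"
    and "augmented_tree.simple_augmented_tree N S ratio K kappa"
    and "bij_betw Tc {1..m} (augmented_tree.component_classes N S ratio K kappa)"
    and "bij_betw tc {1..n} (augmented_tree.vertex_classes N ratio)"
    and "[] \<in> tc 1"
    and "rearrangeable m n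
           (augmented_tree.vertex_incidence N ratio tc)
           (augmented_tree.class_representation Tc tc)
           (augmented_tree.component_incidence N ratio Tc)"
  shows "(\<exists>\<sigma>. near_isometry
            (augmented_tree.vertices N ratio) (augmented_tree.edges N S ratio K kappa)
            (augmented_tree.vertices N ratio) (augmented_tree.vertical_edges N ratio) \<sigma>) \<and>
         (\<forall>\<delta> a. gromov_hyperbolic
              (augmented_tree.vertices N ratio) (augmented_tree.edges N S ratio K kappa) [] \<delta> \<longrightarrow>
            a > 0 \<longrightarrow> exp (3 * \<delta> * a) < sqrt 2 \<longrightarrow>
            lipschitz_equivalent
              (hyperbolic_boundary (augmented_tree.vertices N ratio)
                 (augmented_tree.edges N S ratio K kappa) [] a)
              (boundary_dist (augmented_tree.edges N S ratio K kappa) [] a)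
              (hyperbolic_boundary (augmented_tree.vertices N ratio)
                 (augmented_tree.vertical_edges N ratio) [] a)
              (boundary_dist (augmented_tree.vertical_edges N ratio) [] a))"
proof -
  interpret rearrangeable_augmented_tree N S ratio K kappa m n Tc tc
    using assms unfolding rearrangeable_augmented_tree_def rearrangeable_augmented_tree_axioms_def by blast
  obtain \<sigma> where \<sigma>: "near_isometry vertices edges vertices vertical_edges \<sigma>"
    using ex_near_isometry by blast
  have "[] \<in> vertices" unfolding vertices_def using level_0 by blast
  then have "lipschitz_equivalent
      (hyperbolic_boundary vertices edges [] a) (boundary_dist edges [] a)
      (hyperbolic_boundary vertices vertical_edges [] a) (boundary_dist vertical_edges [] a)"
    if "a > 0" for a
    using lipschitz_equivalent_boundary[OF \<sigma> sym_edges edges_connected _ sym_vertical vertical_connected _ that]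
    by blast
  then show ?thesis using \<sigma> by blast
qed

end
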